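(* Let $\Gamma$ be a strongly connected simple digraph whose adjacency matrix has $d+1$ distinct eigenvalues. Then $\tilde\varepsilon_\Gamma\leq\varepsilon_d$, where $\tilde\varepsilon_\Gamma$ is the weighted excess and $\varepsilon_d$ the spectral excess (defined in the context). Moreover, if $\Gamma$ is a strongly connected normal digraph, then $\tilde\varepsilon_\Gamma=\varepsilon_d$ if and only if $\Gamma$ is distance-regular.
   Context: A simple digraph has no loops or multiple arcs (both $(u,v)$ and $(v,u)$ may be arcs); walks and paths are directed, and "connected" means strongly connected. $\mathbf{A}$ is the adjacency matrix ($\mathbf{A}_{uv}=1$ iff $(u,v)$ is an arc), $n$ the number of vertices; $\Gamma$ is normal if $\mathbf{A}\mathbf{A}^t=\mathbf{A}^t\mathbf{A}$. $\partial(u,v)$ is the directed distance from $u$ to $v$; $\Gamma^+_k(u)=\{v:\partial(u,v)=k\}$; $D$ is the maximum distance. Let $\lambda_0$ be the (real, simple) eigenvalue of $\mathbf{A}$ of maximum modulus, write the minimal polynomial of $\mathbf{A}$ as $(x-\lambda_0)S(x)$, and let $H(x)=nS(x)/S(\lambda_0)$ (Hoffman polynomial). For a vertex $v$ let $\tilde\delta_k(v)=\sum_{u\in\Gamma^+_k(v)}(H(\mathbf{A}))_{vu}^2$ and $\tilde\delta'_k(v)=\sum_{u\in\Gamma^+_k(v)}(H(\mathbf{A}))_{vu}\rho_k(v,u)$, where $\rho_k(v,u)$ is the number of paths of length $k$ from $v$ to $u$; let $\tilde\delta_k=\frac1n\sum_v\tilde\delta_k(v)$, $\tilde\delta'_k=\frac1n\sum_v\tilde\delta'_k(v)$.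 The weighted excess is $\tilde\varepsilon_\Gamma=\tilde\delta'^2_d/\tilde\delta_d$ if $d\le D$ and $0$ if $d>D$. Let $\hat D+1$ be the degree of the minimal polynomial (note $d\le\hat D$). For polynomials $\langle f,g\rangle=\frac1n\operatorname{tr}(f(\mathbf{A})g(\mathbf{A})^* )$; the pre-distance polynomials $\mathcal{P}_0,\dots,\mathcal{P}_{\hat D}$ are obtained by Gram–Schmidt orthogonalization of $1,x,\dots,x^{\hat D}$ with respect to this inner product ($\mathcal P_i$ monic of degree $i$). The spectral excess is $\varepsilon_d=\langle\mathcal P_d,\mathcal P_d\rangle$. $\Gamma$ is distance-regular if for all vertices $u,v$ with $\partial(u,v)=k$, $1\le k\le D$, the numbers $|\Gamma^+_i(u)\cap\Gamma^+_1(v)|$ for $0\le i\le k+1$ depend only on $k$. *)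

theory Defs
  imports
    "Graph_Theory.Digraph_Component"
    "Jordan_Normal_Form.Schur_Decomposition"
    "Jordan_Normal_Form.Spectral_Radius"
begin

section \<open>Polynomials in a square matrix\<close>

definition mat_trace :: "'a :: comm_monoid_add mat \<Rightarrow> 'a" where
  "mat_trace M = (\<Sum>i<dim_row M. M $$ (i, i))"

definition poly_mat :: "'a :: comm_ring_1 poly \<Rightarrow> 'a mat \<Rightarrow> 'a mat" where
  "poly_mat p A = mat (dim_row A) (dim_row A)
     (\<lambda>(i, j). \<Sum>k\<le>degree p. coeff p k * (A ^\<^sub>m k) $$ (i, j))"

definition annihilates :: "'a :: comm_ring_1 poly \<Rightarrow> 'a mat \<Rightarrow> bool" where
  "annihilates p A \<longleftrightarrow> poly_mat p A = 0\<^sub>m (dim_row A) (dim_row A)"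

definition minimal_poly :: "'a :: field mat \<Rightarrow> 'a poly" where
  "minimal_poly A = (THE p. monic p \<and> annihilates p A \<and>
     (\<forall>q. monic q \<and> annihilates q A \<longrightarrow> degree p \<le> degree q))"

definition complex_mat :: "real mat \<Rightarrow> complex mat" where
  "complex_mat A = map_mat complex_of_real A"

text \<open>
  The real eigenvalue of maximum modulus. Other eigenvalues (even \<open>- r\<close>) may have the same
  modulus when the digraph is periodic; requiring \<open>r\<close> itself, and not only \<open>\<bar>r\<bar>\<close>, to bound all
  moduli selects the nonnegative one.
\<close>

definition perron_eigenvalue :: "real mat \<Rightarrow> real" where
  "perron_eigenvalue A = (THE r. eigenvalue (complex_mat A) (complex_of_real r) \<and>
     (\<forall>\<mu>. eigenvalue (complex_mat A) \<mu> \<longrightarrow> cmod \<mu> \<le> r))"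

text \<open>
  The division by \<open>x - r\<close> is exact, as an eigenvalue is a root of the minimal polynomial.
\<close>

definition hoffman_poly :: "real mat \<Rightarrow> real poly" where
  "hoffman_poly A =
     (let r = perron_eigenvalue A; S = minimal_poly A div [:- r, 1:]
      in Polynomial.smult (real (dim_row A) / poly S r) S)"

definition poly_inner :: "real mat \<Rightarrow> real poly \<Rightarrow> real poly \<Rightarrow> real" where
  "poly_inner A f g = mat_trace (poly_mat f A * mat_adjoint (poly_mat g A)) / real (dim_row A)"

text \<open>
  Gram--Schmidt on \<open>1, x, x\<^sup>2, \<dots>\<close> without normalization. Only the indices below the degree of
  the minimal polynomial are meaningful, since \<open>poly_inner A\<close> is definite only up to that degree.
\<close>

fun predistance_poly :: "real mat \<Rightarrow> nat \<Rightarrow> real poly" where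
  "predistance_poly A k = monom 1 k -
     (\<Sum>i<k. Polynomial.smult (poly_inner A (monom 1 k) (predistance_poly A i) /
                   poly_inner A (predistance_poly A i) (predistance_poly A i))
              (predistance_poly A i))"

declare predistance_poly.simps [simp del]

definition spectral_excess :: "real mat \<Rightarrow> nat \<Rightarrow> real" where
  "spectral_excess A d = poly_inner A (predistance_poly A d) (predistance_poly A d)"

definition normal_mat :: "real mat \<Rightarrow> bool" where
  "normal_mat A \<longleftrightarrow> A * transpose_mat A = transpose_mat A * A"


section \<open>Distance in digraphs\<close>

text \<open>\<open>ddist\<close> is meaningful only if \<open>v\<close> is reachable from \<open>u\<close>.\<close>

definition ddist :: "('a, 'b) pre_digraph \<Rightarrow> 'a \<Rightarrow> 'a \<Rightarrow> nat" where
  "ddist G u v = (LEAST k. \<exists>p. pre_digraph.awalk G u p v \<and> length p = k)"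

definition sphere_out :: "('a, 'b) pre_digraph \<Rightarrow> nat \<Rightarrow> 'a \<Rightarrow> 'a set" where
  "sphere_out G k u = {v \<in> verts G. ddist G u v = k}"

definition diam :: "('a, 'b) pre_digraph \<Rightarrow> nat" where
  "diam G = Max {ddist G u v | u v. u \<in> verts G \<and> v \<in> verts G}"

definition num_paths :: "('a, 'b) pre_digraph \<Rightarrow> nat \<Rightarrow> 'a \<Rightarrow> 'a \<Rightarrow> nat" where
  "num_paths G k v u = card {p. pre_digraph.apath G v p u \<and> length p = k}"

definition distance_regular :: "('a, 'b) pre_digraph \<Rightarrow> bool" where
  "distance_regular G \<longleftrightarrow> (\<exists>s :: nat \<Rightarrow> nat \<Rightarrow> nat.
     \<forall>k \<in> {1..diam G}. \<forall>i \<le> k + 1. \<forall>u \<in> verts G. \<forall>v \<in> verts G.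
       ddist G u v = k \<longrightarrow> card (sphere_out G i u \<inter> sphere_out G 1 v) = s i k)"


section \<open>Adjacency matrix and weighted excess\<close>

text \<open>
  Matrices are indexed by natural numbers, so the vertices are numbered by a bijection
  \<open>ix\<close> from \<open>verts G\<close> onto \<open>{..<card (verts G)}\<close>; the entry of \<open>M\<close> at the pair \<open>(u, v)\<close> of vertices
  is \<open>M $$ (ix u, ix v)\<close>.
\<close>

definition adjacency_mat :: "('a, 'b) pre_digraph \<Rightarrow> ('a \<Rightarrow> nat) \<Rightarrow> real mat" where
  "adjacency_mat G ix = mat (card (verts G)) (card (verts G))
     (\<lambda>(i, j). if \<exists>u v. u \<rightarrow>\<^bsub>G\<^esub> v \<and> ix u = i \<and> ix v = j then 1 else 0)"

definition hoffman_entry :: "('a, 'b) pre_digraph \<Rightarrow> ('a \<Rightarrow> nat) \<Rightarrow> 'a \<Rightarrow> 'a \<Rightarrow> real" where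
  "hoffman_entry G ix v u =
     poly_mat (hoffman_poly (adjacency_mat G ix)) (adjacency_mat G ix) $$ (ix v, ix u)"

definition delta :: "('a, 'b) pre_digraph \<Rightarrow> ('a \<Rightarrow> nat) \<Rightarrow> nat \<Rightarrow> real" where
  "delta G ix k = (\<Sum>v\<in>verts G. \<Sum>u\<in>sphere_out G k v. (hoffman_entry G ix v u)\<^sup>2)
     / real (card (verts G))"

definition delta' :: "('a, 'b) pre_digraph \<Rightarrow> ('a \<Rightarrow> nat) \<Rightarrow> nat \<Rightarrow> real" where
  "delta' G ix k =
     (\<Sum>v\<in>verts G. \<Sum>u\<in>sphere_out G k v. hoffman_entry G ix v u * real (num_paths G k v u))
     / real (card (verts G))"

definition weighted_excess :: "('a, 'b) pre_digraph \<Rightarrow> ('a \<Rightarrow> nat) \<Rightarrow> nat \<Rightarrow> real" where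
  "weighted_excess G ix d =
     (if d \<le> diam G then (delta' G ix d)\<^sup>2 / delta G ix d else 0)"

end

theory Submission
  imports Defs
begin

text \<open>
  Let \<open>H\<close> be the Hoffman polynomial, \<open>W\<close> the restriction of \<open>H(A)\<close> to the pairs at distance \<open>d\<close>, and \<open>P\<^sub>k\<close> the
  predistance polynomials. Powers below the \<open>d\<close>-th vanish at distance \<open>d\<close>, so there \<open>A\<^sup>d\<close> and \<open>P\<^sub>d(A)\<close>
  agree and the inequality is Cauchy--Schwarz for \<open>W\<close> and \<open>P\<^sub>d(A)\<close>. No Perron--Frobenius theory is
  needed: equality only says that \<open>P\<^sub>d(A)\<close> is a multiple of \<open>W\<close>, hence supported at distance \<open>d\<close>.

  If \<open>A\<close> is normal, \<open>A\<^sup>T\<close> is a polynomial in \<open>A\<close>, and multiplying \<open>P\<^sub>k(A)\<close> by \<open>A\<^sup>T\<close> shows by downward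
  induction that every \<open>P\<^sub>k(A)\<close> is supported at distance \<open>k\<close>. Thus all polynomials in \<open>A\<close> have constant
  diagonal; for \<open>A\<^sup>T A = A A\<^sup>T\<close> this makes the digraph regular, so \<open>H(A)\<close> is the all-ones matrix. Comparing
  with its expansion, every polynomial in \<open>A\<close> has entries depending only on the distance, and the
  intersection numbers are the entries of \<open>A\<^sub>i A\<^sup>T\<close>.

  Conversely, distance-regularity says that right multiplication by \<open>A\<^sup>T\<close>, hence by \<open>A\<close>, preserves the
  matrices whose entries depend only on the distance. So \<open>P\<^sub>d(A)\<close> is such a matrix, and orthogonality to
  the lower powers of \<open>A\<close> forces its support to distance \<open>d\<close>, where \<open>W\<close> has all entries 1.
\<close>

section \<open>Polynomials in a matrix\<close>

lemma poly_mat_carrier [simp]: "A \<in> carrier_mat n n \<Longrightarrow> poly_mat p A \<in> carrier_mat n n"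
  by (auto simp: poly_mat_def)

lemma dim_poly_mat [simp]:
  "dim_row (poly_mat p A) = dim_row A" "dim_col (poly_mat p A) = dim_row A"
  by (simp_all add: poly_mat_def)

text \<open>The free bound \<open>N\<close> lets polynomials of different degrees be compared over
  one index range.\<close>

lemma poly_mat_index_le:
  assumes "A \<in> carrier_mat n n" "i < n" "j < n" "degree p \<le> N"
  shows "poly_mat p A $$ (i, j) = (\<Sum>k\<le>N. coeff p k * (A ^\<^sub>m k) $$ (i, j))"
proof -
  have "poly_mat p A $$ (i, j) = (\<Sum>k\<le>degree p. coeff p k * (A ^\<^sub>m k) $$ (i, j))"
    using assms by (auto simp: poly_mat_def)
  also have "\<dots> = (\<Sum>k\<le>N. coeff p k * (A ^\<^sub>m k) $$ (i, j))"
    using assms by (intro sum.mono_neutral_left) (auto simp: coeff_eq_0)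
  finally show ?thesis .
qed

lemma poly_mat_0 [simp]: "A \<in> carrier_mat n n \<Longrightarrow> poly_mat 0 A = 0\<^sub>m n n"
  by (auto simp: poly_mat_def)

lemma poly_mat_add:
  assumes "A \<in> carrier_mat n n"
  shows "poly_mat (p + q) A = poly_mat p A + poly_mat q A"
proof (rule eq_matI)
  fix i j assume "i < dim_row (poly_mat p A + poly_mat q A)" "j < dim_col (poly_mat p A + poly_mat q A)"
  then have ij: "i < n" "j < n" using assms by (auto simp: poly_mat_def)
  let ?N = "max (degree p) (degree q)"
  show "poly_mat (p + q) A $$ (i, j) = (poly_mat p A + poly_mat q A) $$ (i, j)"
    using ij assms poly_mat_index_le[OF assms ij, of p ?N] poly_mat_index_le[OF assms ij, of q ?N]
      poly_mat_index_le[OF assms ij, of "p + q" ?N]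
    by (auto simp: degree_add_le_max poly_mat_def distrib_right sum.distrib)
qed (use assms in \<open>auto simp: poly_mat_def\<close>)

lemma poly_mat_smult:
  assumes "A \<in> carrier_mat n n"
  shows "poly_mat (Polynomial.smult c p) A = c \<cdot>\<^sub>m poly_mat p A"
proof (rule eq_matI)
  fix i j assume "i < dim_row (c \<cdot>\<^sub>m poly_mat p A)" "j < dim_col (c \<cdot>\<^sub>m poly_mat p A)"
  then have ij: "i < n" "j < n" using assms by (auto simp: poly_mat_def)
  show "poly_mat (Polynomial.smult c p) A $$ (i, j) = (c \<cdot>\<^sub>m poly_mat p A) $$ (i, j)"
    using ij assms poly_mat_index_le[OF assms ij, of p "degree p"]
      poly_mat_index_le[OF assms ij, of "Polynomial.smult c p" "degree p"]
    by (auto simp: degree_smult_le poly_mat_def sum_distrib_left mult.assoc)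
qed (use assms in \<open>auto simp: poly_mat_def\<close>)

lemma poly_mat_index_add:
  assumes "A \<in> carrier_mat n n" "i < n" "j < n"
  shows "poly_mat (p + q) A $$ (i, j) = poly_mat p A $$ (i, j) + poly_mat q A $$ (i, j)"
  using assms by (subst poly_mat_add) (auto simp: poly_mat_def)

lemma poly_mat_index_smult:
  assumes "A \<in> carrier_mat n n" "i < n" "j < n"
  shows "poly_mat (Polynomial.smult c p) A $$ (i, j) = c * poly_mat p A $$ (i, j)"
  using assms by (subst poly_mat_smult) (auto simp: poly_mat_def)

lemma poly_mat_index_diff:
  assumes "A \<in> carrier_mat n n" "i < n" "j < n"
  shows "poly_mat (p - q) A $$ (i, j) = poly_mat p A $$ (i, j) - poly_mat q A $$ (i, j)"
  using poly_mat_index_add[OF assms, of "p - q" q] by simp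

lemma poly_mat_index_sum:
  assumes "A \<in> carrier_mat n n" "i < n" "j < n"
  shows "poly_mat (sum f I) A $$ (i, j) = (\<Sum>x\<in>I. poly_mat (f x) A $$ (i, j))"
  by (induction I rule: infinite_finite_induct)
    (use assms in \<open>auto simp: poly_mat_index_add\<close>)

lemma poly_mat_diff:
  assumes "A \<in> carrier_mat n n"
  shows "poly_mat (p - q) A = poly_mat p A - poly_mat q A"
proof (rule eq_matI)
  fix i j assume "i < dim_row (poly_mat p A - poly_mat q A)" "j < dim_col (poly_mat p A - poly_mat q A)"
  then have ij: "i < n" "j < n" using assms by (auto simp: poly_mat_def)
  show "poly_mat (p - q) A $$ (i, j) = (poly_mat p A - poly_mat q A) $$ (i, j)"
    using ij assms poly_mat_index_diff[OF assms ij] by (auto simp: poly_mat_def)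
qed (use assms in \<open>auto simp: poly_mat_def\<close>)

lemma pow_mat_Suc_left:
  assumes "A \<in> carrier_mat n n"
  shows "A ^\<^sub>m Suc k = A * A ^\<^sub>m k"
proof (induction k)
  case (Suc k)
  have "A ^\<^sub>m Suc (Suc k) = (A * A ^\<^sub>m k) * A" using Suc by simp
  also have "\<dots> = A * (A ^\<^sub>m k * A)" using assms by (intro assoc_mult_mat) auto
  finally show ?case by simp
qed (use assms in auto)

text \<open>Horner's rule; it is the induction step over \<open>pCons\<close> in the multiplication,
  commutation and eigenvector lemmas.\<close>

lemma poly_mat_pCons:
  assumes A: "A \<in> carrier_mat n n"
  shows "poly_mat (pCons a p) A = a \<cdot>\<^sub>m 1\<^sub>m n + A * poly_mat p A"
proof (rule eq_matI)
  fix i j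
  assume "i < dim_row (a \<cdot>\<^sub>m 1\<^sub>m n + A * poly_mat p A)" "j < dim_col (a \<cdot>\<^sub>m 1\<^sub>m n + A * poly_mat p A)"
  then have ij: "i < n" "j < n" using assms by (auto simp: poly_mat_def)
  have "(A * poly_mat p A) $$ (i, j) = (\<Sum>l<n. A $$ (i, l) * poly_mat p A $$ (l, j))"
    using A ij by (auto simp: times_mat_def scalar_prod_def poly_mat_def atLeast0LessThan)
  also have "\<dots> = (\<Sum>l<n. \<Sum>k\<le>degree p. A $$ (i, l) * (coeff p k * (A ^\<^sub>m k) $$ (l, j)))"
    by (intro sum.cong refl) (use poly_mat_index_le[OF A _ ij(2), of _ p "degree p"] in
      \<open>auto simp: sum_distrib_left\<close>)
  also have "\<dots> = (\<Sum>k\<le>degree p. coeff p k * (\<Sum>l<n. A $$ (i, l) * (A ^\<^sub>m k) $$ (l, j)))"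
    by (subst sum.swap) (simp add: sum_distrib_left mult.left_commute)
  also have "\<dots> = (\<Sum>k\<le>degree p. coeff p k * (A ^\<^sub>m Suc k) $$ (i, j))"
    unfolding pow_mat_Suc_left[OF A]
    using A ij by (intro sum.cong refl)
      (auto simp: times_mat_def scalar_prod_def atLeast0LessThan pow_carrier_mat[OF A])
  finally have 1: "(A * poly_mat p A) $$ (i, j) = \<dots>" .
  have "poly_mat (pCons a p) A $$ (i, j)
      = (\<Sum>k\<le>Suc (degree p). coeff (pCons a p) k * (A ^\<^sub>m k) $$ (i, j))"
    by (rule poly_mat_index_le[OF A ij]) (simp add: degree_pCons_le)
  also have "\<dots> = a * (1\<^sub>m n) $$ (i, j) + (\<Sum>k\<le>degree p. coeff p k * (A ^\<^sub>m Suc k) $$ (i, j))"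
    using A by (subst sum.atMost_Suc_shift) simp
  finally show "poly_mat (pCons a p) A $$ (i, j) = (a \<cdot>\<^sub>m 1\<^sub>m n + A * poly_mat p A) $$ (i, j)"
    using 1 ij A by (auto simp: poly_mat_def)
qed (use assms in \<open>auto simp: poly_mat_def\<close>)

lemma poly_mat_1 [simp]: "A \<in> carrier_mat n n \<Longrightarrow> poly_mat 1 A = 1\<^sub>m n"
  by (rule eq_matI) (auto simp: poly_mat_def)

lemma poly_mat_const:
  assumes "A \<in> carrier_mat n n" shows "poly_mat [:a:] A = a \<cdot>\<^sub>m 1\<^sub>m n"
proof -
  have "a \<cdot>\<^sub>m 1\<^sub>m n \<in> carrier_mat n n" by simp
  then show ?thesis
    using poly_mat_pCons[OF assms, of a 0] assms right_mult_zero_mat[OF assms] by simp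
qed

lemma poly_mat_monom:
  assumes A: "A \<in> carrier_mat n n" shows "poly_mat (monom 1 k) A = A ^\<^sub>m k"
proof (rule eq_matI)
  fix i j assume "i < dim_row (A ^\<^sub>m k)" "j < dim_col (A ^\<^sub>m k)"
  then have ij: "i < n" "j < n" using pow_carrier_mat[OF A, of k] by auto
  show "poly_mat (monom 1 k) A $$ (i, j) = (A ^\<^sub>m k) $$ (i, j)"
    unfolding poly_mat_index_le[OF A ij degree_monom_le]
    by (subst sum.remove[of _ k]) (auto simp: if_distrib[of "\<lambda>x. x * _"] cong: if_cong)
qed (use assms pow_carrier_mat[OF A, of k] in \<open>auto simp: poly_mat_def\<close>)

lemma poly_mat_linear:
  assumes A: "A \<in> carrier_mat n n"
  shows "poly_mat [:- c, 1:] A = A - c \<cdot>\<^sub>m 1\<^sub>m n"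
proof (rule eq_matI)
  fix i j assume "i < dim_row (A - c \<cdot>\<^sub>m 1\<^sub>m n)" "j < dim_col (A - c \<cdot>\<^sub>m 1\<^sub>m n)"
  then show "poly_mat [:- c, 1:] A $$ (i, j) = (A - c \<cdot>\<^sub>m 1\<^sub>m n) $$ (i, j)"
    using A poly_mat_pCons[OF A, of "- c" "[:1:]"] poly_mat_const[OF A, of 1] by auto
qed (use assms in \<open>auto simp: poly_mat_def\<close>)

lemma poly_mat_mult:
  assumes A: "A \<in> carrier_mat n n"
  shows "poly_mat (p * q) A = poly_mat p A * poly_mat q A"
proof (induction p)
  case 0
  then show ?case using A left_mult_zero_mat[OF poly_mat_carrier[OF A]] by simp
next
  case (pCons a p)
  have "poly_mat (pCons a p) A * poly_mat q A
      = (a \<cdot>\<^sub>m 1\<^sub>m n) * poly_mat q A + (A * poly_mat p A) * poly_mat q A"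
    unfolding poly_mat_pCons[OF A] by (rule add_mult_distrib_mat[of _ n n _ _ n]) (use A in auto)
  also have "(a \<cdot>\<^sub>m 1\<^sub>m n) * poly_mat q A = a \<cdot>\<^sub>m poly_mat q A"
    using mult_smult_assoc_mat[OF one_carrier_mat poly_mat_carrier[OF A], of a q]
      left_mult_one_mat[OF poly_mat_carrier[OF A], of q] by simp
  also have "\<dots> = poly_mat (Polynomial.smult a q) A" by (simp add: poly_mat_smult[OF A])
  also have "(A * poly_mat p A) * poly_mat q A = A * (poly_mat p A * poly_mat q A)"
    by (rule assoc_mult_mat[of _ n n _ n _ n]) (use A in auto)
  also have "\<dots> = poly_mat (pCons 0 (p * q)) A"
    unfolding poly_mat_pCons[OF A] pCons(2)[symmetric]
    using A poly_mat_carrier[OF A, of "p * q"] by (intro eq_matI) auto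
  also have "poly_mat (Polynomial.smult a q) A + \<dots> = poly_mat (pCons a p * q) A"
    by (simp add: poly_mat_add[OF A] mult_pCons_left)
  finally show ?case ..
qed

text \<open>\<open>X\<close> is arbitrary because the lemma is applied to \<open>A\<close> itself,
  to its adjoint and to adjoints of polynomials in \<open>A\<close>.\<close>

lemma poly_mat_commute:
  assumes A: "A \<in> carrier_mat n n" and X: "X \<in> carrier_mat n n" and c: "X * A = A * X"
  shows "X * poly_mat p A = poly_mat p A * X"
proof (induction p)
  case 0
  then show ?case using A X left_mult_zero_mat[OF X] right_mult_zero_mat[OF X] by simp
next
  case (pCons a p)
  have "X * poly_mat (pCons a p) A = X * (a \<cdot>\<^sub>m 1\<^sub>m n) + X * (A * poly_mat p A)"
    unfolding poly_mat_pCons[OF A] by (rule mult_add_distrib_mat[of _ n n _ n]) (use A X in auto)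
  also have "X * (a \<cdot>\<^sub>m 1\<^sub>m n) = (a \<cdot>\<^sub>m 1\<^sub>m n) * X"
    using X by (simp add: mult_smult_assoc_mat[OF one_carrier_mat X] mult_smult_distrib[OF X one_carrier_mat])
  also have "X * (A * poly_mat p A) = (X * A) * poly_mat p A"
    by (rule assoc_mult_mat[of _ n n _ n _ n, symmetric]) (use A X in auto)
  also have "\<dots> = A * (X * poly_mat p A)" unfolding c
    by (rule assoc_mult_mat[of _ n n _ n _ n]) (use A X in auto)
  also have "\<dots> = (A * poly_mat p A) * X" unfolding pCons(2)
    by (rule assoc_mult_mat[of _ n n _ n _ n, symmetric]) (use A X in auto)
  also have "(a \<cdot>\<^sub>m 1\<^sub>m n) * X + (A * poly_mat p A) * X = poly_mat (pCons a p) A * X"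
    unfolding poly_mat_pCons[OF A] by (rule add_mult_distrib_mat[of _ n n _ _ n, symmetric]) (use A X in auto)
  finally show ?case .
qed

section \<open>Annihilating polynomials and eigenvalues\<close>

lemma poly_mat_eigenvector:
  fixes A :: "'a :: field mat"
  assumes A: "A \<in> carrier_mat n n" and "eigenvector A v k"
  shows "poly_mat p A *\<^sub>v v = poly p k \<cdot>\<^sub>v v"
proof -
  have v: "v \<in> carrier_vec n" and Av: "A *\<^sub>v v = k \<cdot>\<^sub>v v"
    using assms by (auto simp: eigenvector_def)
  show ?thesis
  proof (induction p)
    case 0
    show ?case using A v by (intro eq_vecI) auto
  next
    case (pCons a p)
    have "poly_mat (pCons a p) A *\<^sub>v v = (a \<cdot>\<^sub>m 1\<^sub>m n) *\<^sub>v v + (A * poly_mat p A) *\<^sub>v v"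
      unfolding poly_mat_pCons[OF A]
      by (rule add_mult_distrib_mat_vec[of _ n n]) (use A v in auto)
    also have "A * poly_mat p A = poly_mat p A * A"
      by (rule poly_mat_commute[OF A A refl])
    also have "(poly_mat p A * A) *\<^sub>v v = poly_mat p A *\<^sub>v (k \<cdot>\<^sub>v v)"
      unfolding Av[symmetric] by (rule assoc_mult_mat_vec[of _ n n _ n]) (use A v in auto)
    also have "\<dots> = k \<cdot>\<^sub>v (poly p k \<cdot>\<^sub>v v)"
      unfolding pCons(2)[symmetric] by (rule mult_mat_vec) (use A v in auto)
    also have "(a \<cdot>\<^sub>m 1\<^sub>m n) *\<^sub>v v = a \<cdot>\<^sub>v v"
      using v by (intro eq_vecI) auto
    finally show ?case using v by (auto simp: add_smult_distrib_vec smult_smult_assoc)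
  qed
qed

lemma annihilates_eigenvalue:
  fixes A :: "'a :: field mat"
  assumes A: "A \<in> carrier_mat n n" and "annihilates p A" "eigenvalue A k"
  shows "poly p k = 0"
proof -
  obtain v where v: "eigenvector A v k" using assms by (auto simp: eigenvalue_def)
  then have vn: "v \<in> carrier_vec n" "v \<noteq> 0\<^sub>v n" using A by (auto simp: eigenvector_def)
  have "poly p k \<cdot>\<^sub>v v = 0\<^sub>m n n *\<^sub>v v"
    using poly_mat_eigenvector[OF A v, of p] assms by (simp add: annihilates_def)
  then have "poly p k \<cdot>\<^sub>v v = 0\<^sub>v n" using vn by auto
  moreover from vn obtain i where "i < n" "v $ i \<noteq> 0" by (auto simp: vec_eq_iff)
  ultimately show ?thesis using vn
    by (auto simp: vec_eq_iff)
qed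

text \<open>Every eigenvalue is a root of \<open>p\<close>. Read the other way, a nonzero polynomial
  of smaller degree cannot annihilate \<open>A\<close>; this later makes the inner product
  definite.\<close>

lemma card_spectrum_le_degree:
  fixes A :: "'a :: field mat"
  assumes A: "A \<in> carrier_mat n n" and "annihilates p A" "p \<noteq> 0"
  shows "card (spectrum A) \<le> degree p"
proof -
  have "spectrum A \<subseteq> {x. poly p x = 0}"
    using annihilates_eigenvalue[OF A assms(2)] by (auto simp: spectrum_def)
  then have "card (spectrum A) \<le> card {x. poly p x = 0}"
    using poly_roots_finite[OF assms(3)] by (rule card_mono[rotated])
  also have "\<dots> \<le> degree p" by (rule poly_roots_degree[OF assms(3)])
  finally show ?thesis .
qed

text \<open>The \<open>n\<^sup>2 + 2\<close> powers below live in a space of dimension \<open>n\<^sup>2\<close>.\<close>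

lemma ex_monic_annihilating:
  fixes A :: "'a :: field mat"
  assumes A: "A \<in> carrier_mat n n"
  shows "\<exists>p. monic p \<and> annihilates p A"
proof -
  \<comment> \<open>Column \<open>k\<close> of \<open>M\<close> lists the entries of
    \<open>A ^\<^sub>m k\<close> row by row. The two extra rows are zero, hence equal, so
    \<open>det M = 0\<close>, and a kernel vector is the coefficient list of an annihilating
    polynomial.\<close>
  define N where "N = n * n + 2"
  define M where "M = mat N N (\<lambda>(r, k). if r < n * n then (A ^\<^sub>m k) $$ (r div n, r mod n) else 0)"
  have M: "M \<in> carrier_mat N N" by (simp add: M_def)
  have "det M = 0"
    by (rule det_identical_rows[OF M, of "n * n" "n * n + 1"])
      (auto simp: M_def N_def)
  then obtain v where v: "v \<in> carrier_vec N" "v \<noteq> 0\<^sub>v N" "M *\<^sub>v v = 0\<^sub>v N"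
    using det_0_iff_vec_prod_zero_field[OF M] by auto
  define p where "p = (\<Sum>k<N. monom (v $ k) k)"
  have cf: "coeff p k = (if k < N then v $ k else 0)" for k
    by (simp add: p_def coeff_sum sum.delta)
  obtain l where "l < N" "v $ l \<noteq> 0" using v(1,2) by (auto simp: vec_eq_iff)
  then have p0: "p \<noteq> 0" using cf[of l] by auto
  have deg: "degree p \<le> N" by (rule degree_le) (simp add: cf)
  have "poly_mat p A $$ (i, j) = 0" if ij: "i < n" "j < n" for i j
  proof -
    let ?r = "i * n + j"
    have "?r < Suc i * n" using ij by simp
    also have "\<dots> \<le> n * n" using ij by (intro mult_right_mono) auto
    finally have r: "?r < n * n" .
    have "0 = (M *\<^sub>v v) $ ?r" using v(3) r by (simp add: N_def)
    also have "\<dots> = (\<Sum>k<N. M $$ (?r, k) * v $ k)"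
      using r v(1) M by (auto simp: scalar_prod_def N_def atLeast0LessThan)
    also have "\<dots> = (\<Sum>k<N. coeff p k * (A ^\<^sub>m k) $$ (i, j))"
      using r ij by (intro sum.cong) (auto simp: M_def N_def cf)
    also have "\<dots> = (\<Sum>k\<le>N. coeff p k * (A ^\<^sub>m k) $$ (i, j))"
      by (rule sum.mono_neutral_left) (auto simp: cf)
    also have "\<dots> = poly_mat p A $$ (i, j)"
      by (rule poly_mat_index_le[OF A ij deg, symmetric])
    finally show ?thesis by simp
  qed
  then have "poly_mat (Polynomial.smult (inverse (lead_coeff p)) p) A = 0\<^sub>m n n"
    unfolding poly_mat_smult[OF A] using A by (intro eq_matI) auto
  then show ?thesis using p0 A
    by (intro exI[of _ "Polynomial.smult (inverse (lead_coeff p)) p"]) (auto simp: annihilates_def)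
qed

section \<open>The minimal polynomial\<close>

lemma ex_min_annihilating:
  fixes A :: "'a :: field mat"
  assumes A: "A \<in> carrier_mat n n"
  shows "\<exists>p. monic p \<and> annihilates p A \<and> (\<forall>q. monic q \<and> annihilates q A \<longrightarrow> degree p \<le> degree q)"
  using ex_has_least_nat[of "\<lambda>p. monic p \<and> annihilates p A" _ degree] ex_monic_annihilating[OF A]
  by blast

text \<open>Dividing by the leading coefficient would give a monic annihilating polynomial of degree
  below \<open>N\<close>. The bound stays abstract because the lemma also serves the uniqueness
  proof behind \<open>minimal_poly\<close>.\<close>

lemma degree_less_min_annihilating:
  fixes A :: "'a :: field mat"
  assumes A: "A \<in> carrier_mat n n"
    and min: "\<And>q. monic q \<Longrightarrow> annihilates q A \<Longrightarrow> N \<le> degree q"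
    and "annihilates q A" "degree q < N"
  shows "q = 0"
proof (rule ccontr)
  assume "q \<noteq> 0"
  let ?q = "Polynomial.smult (inverse (lead_coeff q)) q"
  have "annihilates ?q A" using assms(3) A by (auto simp: annihilates_def poly_mat_smult[OF A])
  moreover have "monic ?q" using \<open>q \<noteq> 0\<close> by simp
  ultimately show False using min[of ?q] \<open>q \<noteq> 0\<close> assms(4) by simp
qed

lemma annihilates_diff:
  assumes A: "A \<in> carrier_mat n n" and "annihilates p A" "annihilates q A"
  shows "annihilates (p - q) A"
  using assms by (auto simp: annihilates_def poly_mat_diff[OF A])

text \<open>Two candidates are monic of the same degree, so their difference annihilates
  \<open>A\<close> with smaller degree and is zero. Hence the definite description denotes.\<close>

lemma minimal_poly:
  fixes A :: "'a :: field mat"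
  assumes A: "A \<in> carrier_mat n n"
  shows "monic (minimal_poly A)" "annihilates (minimal_poly A) A"
    "annihilates q A \<Longrightarrow> degree q < degree (minimal_poly A) \<Longrightarrow> q = 0"
proof -
  let ?P = "\<lambda>p. monic p \<and> annihilates p A \<and> (\<forall>q. monic q \<and> annihilates q A \<longrightarrow> degree p \<le> degree q)"
  obtain p where p: "?P p" using ex_min_annihilating[OF A] by blast
  have uniq: "q = p" if q: "?P q" for q
  proof (rule ccontr)
    assume "q \<noteq> p"
    have eq: "degree q = degree p" using p q by (simp add: le_antisym)
    have "degree (q - p) < degree p"
    proof -
      have "coeff (q - p) (degree p) = 0" using p q eq by simp
      moreover have "degree (q - p) \<le> degree p" using degree_diff_le[of q "degree p" p] eq by simp
      moreover have "coeff (q - p) (degree (q - p)) \<noteq> 0"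
        using \<open>q \<noteq> p\<close> leading_coeff_0_iff[of "q - p"] by (simp del: coeff_diff)
      ultimately show ?thesis by (cases "degree (q - p) = degree p") (auto simp del: coeff_diff)
    qed
    then have "q - p = 0"
      using p q by (intro degree_less_min_annihilating[OF A, of "degree p"] annihilates_diff[OF A]) auto
    then show False using \<open>q \<noteq> p\<close> by simp
  qed
  have P: "?P (minimal_poly A)"
    unfolding minimal_poly_def by (rule theI[of ?P p, OF p uniq])
  then show "monic (minimal_poly A)" "annihilates (minimal_poly A) A" by auto
  show "annihilates q A \<Longrightarrow> degree q < degree (minimal_poly A) \<Longrightarrow> q = 0"
    using P by (intro degree_less_min_annihilating[OF A, of "degree (minimal_poly A)"]) auto
qed

section \<open>Normal matrices\<close>

lemma mat_adjoint_carrier [simp]: "A \<in> carrier_mat n m \<Longrightarrow> mat_adjoint A \<in> carrier_mat m n"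
  by (auto simp: mat_adjoint_def mat_of_rows_def)

lemma dim_mat_adjoint [simp]:
  "dim_row (mat_adjoint A) = dim_col A" "dim_col (mat_adjoint A) = dim_row A"
  by (simp_all add: mat_adjoint_def mat_of_rows_def)

lemma index_mat_adjoint [simp]:
  "i < dim_col A \<Longrightarrow> j < dim_row A \<Longrightarrow> mat_adjoint A $$ (i, j) = conjugate (A $$ (j, i))"
  by (simp add: mat_adjoint_def mat_of_rows_index)

lemma mat_adjoint_adjoint [simp]: "mat_adjoint (mat_adjoint A) = A"
  by (rule eq_matI) auto

lemma mat_adjoint_mult:
  assumes "A \<in> carrier_mat n k" "B \<in> carrier_mat k m"
  shows "mat_adjoint (A * B) = mat_adjoint B * mat_adjoint A"
  using assms by (intro eq_matI)
    (auto simp: times_mat_def scalar_prod_def sum_conjugate conjugate_dist_mul mult.commute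
      intro!: sum.cong)

lemma mat_adjoint_diff:
  fixes A :: "complex mat"
  assumes "A \<in> carrier_mat n m" "B \<in> carrier_mat n m"
  shows "mat_adjoint (A - B) = mat_adjoint A - mat_adjoint B"
  using assms by (intro eq_matI) auto

text \<open>The diagonal entries of \<open>mat_adjoint M * M\<close> are the squared norms of the
  columns of \<open>M\<close>.\<close>

lemma adjoint_mult_self_eq_0:
  fixes M :: "complex mat"
  assumes M: "M \<in> carrier_mat n m" and z: "mat_adjoint M * M = 0\<^sub>m m m"
  shows "M = 0\<^sub>m n m"
proof (rule eq_matI)
  fix i j assume "i < dim_row (0\<^sub>m n m)" "j < dim_col (0\<^sub>m n m)"
  then have ij: "i < n" "j < m" by auto
  have "0 = (mat_adjoint M * M) $$ (j, j)" using z ij by simp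
  also have "\<dots> = (\<Sum>k<n. cnj (M $$ (k, j)) * M $$ (k, j))"
    using M ij by (auto simp: times_mat_def scalar_prod_def atLeast0LessThan)
  also have "\<dots> = complex_of_real (\<Sum>k<n. (cmod (M $$ (k, j)))\<^sup>2)"
    by (simp add: complex_norm_square[symmetric] mult.commute)
  finally have "(\<Sum>k<n. (cmod (M $$ (k, j)))\<^sup>2) = 0" by (metis of_real_eq_0_iff)
  then have "(cmod (M $$ (i, j)))\<^sup>2 = 0" using ij by (subst (asm) sum_nonneg_eq_0_iff) auto
  then show "M $$ (i, j) = 0\<^sub>m n m $$ (i, j)" using ij by simp
qed (use M in auto)

definition normal_cmat :: "nat \<Rightarrow> complex mat \<Rightarrow> bool" where
  "normal_cmat n N \<longleftrightarrow> N \<in> carrier_mat n n \<and> mat_adjoint N * N = N * mat_adjoint N"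

text \<open>A normal matrix and its adjoint map each vector to vectors of equal norm. In matrix
  form, \<open>mat_adjoint K * N * mat_adjoint N * K\<close> can be rearranged to end in
  \<open>N * K\<close>.\<close>

lemma normal_cmat_adjoint_mult_eq_0:
  assumes N: "normal_cmat n N" and K: "K \<in> carrier_mat n n" and z: "N * K = 0\<^sub>m n n"
  shows "mat_adjoint N * K = 0\<^sub>m n n"
proof (rule adjoint_mult_self_eq_0)
  have c: "N \<in> carrier_mat n n" and nn: "mat_adjoint N * N = N * mat_adjoint N"
    using N by (auto simp: normal_cmat_def)
  note [simp] = c K
  have "mat_adjoint (mat_adjoint N * K) * (mat_adjoint N * K)
      = mat_adjoint K * N * (mat_adjoint N * K)"
    by (subst mat_adjoint_mult[of _ n n _ n]) auto
  also have "\<dots> = mat_adjoint K * (N * (mat_adjoint N * K))"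
    by (rule assoc_mult_mat[of _ n n _ n _ n]) (auto intro: mult_carrier_mat[of _ n n])
  also have "N * (mat_adjoint N * K) = N * mat_adjoint N * K"
    by (rule assoc_mult_mat[of _ n n _ n _ n, symmetric]) auto
  also have "\<dots> = mat_adjoint N * (N * K)" unfolding nn[symmetric]
    by (rule assoc_mult_mat[of _ n n _ n _ n]) auto
  also have "mat_adjoint K * (mat_adjoint N * (N * K)) = 0\<^sub>m n n"
    unfolding z using right_mult_zero_mat[OF mat_adjoint_carrier[OF c], of n]
      right_mult_zero_mat[OF mat_adjoint_carrier[OF K], of n] by simp
  finally show "mat_adjoint (mat_adjoint N * K) * (mat_adjoint N * K) = 0\<^sub>m n n" .
qed (use N K in \<open>auto simp: normal_cmat_def intro: mult_carrier_mat[of _ n n]\<close>)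

text \<open>A normal matrix and its square have the same kernel: by the preceding lemma
  \<open>mat_adjoint N\<close> kills \<open>N * K\<close>, so the columns of \<open>N * K\<close>
  have norm zero.\<close>

lemma normal_cmat_mult_mult_eq_0:
  assumes N: "normal_cmat n N" and K: "K \<in> carrier_mat n n" and z: "N * (N * K) = 0\<^sub>m n n"
  shows "N * K = 0\<^sub>m n n"
proof (rule adjoint_mult_self_eq_0)
  have c: "N \<in> carrier_mat n n" using N by (auto simp: normal_cmat_def)
  have NK: "N * K \<in> carrier_mat n n" using c K by simp
  have "mat_adjoint (N * K) * (N * K) = mat_adjoint K * mat_adjoint N * (N * K)"
    by (subst mat_adjoint_mult[OF c K]) auto
  also have "\<dots> = mat_adjoint K * (mat_adjoint N * (N * K))"
    by (rule assoc_mult_mat[of _ n n _ n _ n]) (use c K NK in auto)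
  also have "\<dots> = 0\<^sub>m n n"
    unfolding normal_cmat_adjoint_mult_eq_0[OF N NK z]
    using right_mult_zero_mat[OF mat_adjoint_carrier[OF K], of n] by simp
  finally show "mat_adjoint (N * K) * (N * K) = 0\<^sub>m n n" .
qed (use N K in \<open>auto simp: normal_cmat_def\<close>)

section \<open>Polynomials in a normal matrix\<close>

lemma poly_mat_commute_adjoint:
  assumes "normal_cmat n A"
  shows "mat_adjoint A * poly_mat p A = poly_mat p A * mat_adjoint A"
  by (rule poly_mat_commute) (use assms in \<open>auto simp: normal_cmat_def\<close>)

text \<open>Taking adjoints in the preceding lemma shows that the adjoint of
  \<open>poly_mat p A\<close> commutes with \<open>A\<close>, hence with every polynomial in
  \<open>A\<close>.\<close>

lemma normal_cmat_poly_mat: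
  assumes N: "normal_cmat n A" shows "normal_cmat n (poly_mat p A)"
proof -
  have A: "A \<in> carrier_mat n n" using N by (auto simp: normal_cmat_def)
  have "mat_adjoint (mat_adjoint A * poly_mat p A) = mat_adjoint (poly_mat p A * mat_adjoint A)"
    by (simp add: poly_mat_commute_adjoint[OF N])
  then have "mat_adjoint (poly_mat p A) * A = A * mat_adjoint (poly_mat p A)"
    using A by (simp add: mat_adjoint_mult[of _ n n _ n])
  then show ?thesis unfolding normal_cmat_def
    using poly_mat_commute[OF A, of "mat_adjoint (poly_mat p A)" p] A by simp
qed

text \<open>Write the minimal polynomial as \<open>[:- z, 1:] * q\<close>. By minimality
  \<open>poly_mat q A\<close> is not zero, and any nonzero column of it is an eigenvector for
  \<open>z\<close>.\<close>

lemma minimal_poly_root_eigenvalue: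
  fixes A :: "'a :: field mat"
  assumes A: "A \<in> carrier_mat n n" and z: "poly (minimal_poly A) z = 0"
  shows "eigenvalue A z"
proof -
  obtain q where q: "minimal_poly A = [:- z, 1:] * q" using z by (auto simp: poly_eq_0_iff_dvd)
  have m0: "minimal_poly A \<noteq> 0" using minimal_poly(1)[OF A] by auto
  then have q0: "q \<noteq> 0" using q by auto
  have "degree (minimal_poly A) = Suc (degree q)" unfolding q using q0 using degree_mult_eq[of "[:- z, 1:]" q] by simp
  then have na: "\<not> annihilates q A" using minimal_poly(3)[OF A, of q] q0 by auto
  have "\<exists>i<n. \<exists>j<n. poly_mat q A $$ (i, j) \<noteq> 0"
  proof (rule ccontr)
    assume "\<not> ?thesis"
    then have "poly_mat q A = 0\<^sub>m n n" using A by (intro eq_matI) auto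
    then show False using na A by (simp add: annihilates_def)
  qed
  then obtain i j where ij: "i < n" "j < n" "poly_mat q A $$ (i, j) \<noteq> 0" by blast
  have v0: "col (poly_mat q A) j \<noteq> 0\<^sub>v n"
  proof
    assume "col (poly_mat q A) j = 0\<^sub>v n"
    from arg_cong[OF this, of "\<lambda>v. v $ i"] show False using ij A by simp
  qed
  note j = ij(2)
  have "0\<^sub>m n n = (A - z \<cdot>\<^sub>m 1\<^sub>m n) * poly_mat q A"
    using minimal_poly(2)[OF A] A by (simp add: q annihilates_def poly_mat_mult[OF A] poly_mat_linear[OF A] del: mult_pCons_left)
  also have "\<dots> = A * poly_mat q A - (z \<cdot>\<^sub>m 1\<^sub>m n) * poly_mat q A"
    by (rule minus_mult_distrib_mat[of _ n n _ _ n]) (use A in auto)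
  also have "(z \<cdot>\<^sub>m 1\<^sub>m n) * poly_mat q A = z \<cdot>\<^sub>m poly_mat q A"
    using mult_smult_assoc_mat[OF one_carrier_mat poly_mat_carrier[OF A], of z q]
      left_mult_one_mat[OF poly_mat_carrier[OF A], of q] by simp
  finally have e: "0\<^sub>m n n = A * poly_mat q A - z \<cdot>\<^sub>m poly_mat q A" .
  have "A *\<^sub>v col (poly_mat q A) j = z \<cdot>\<^sub>v col (poly_mat q A) j"
  proof (rule eq_vecI)
    fix i assume "i < dim_vec (z \<cdot>\<^sub>v col (poly_mat q A) j)"
    then have i: "i < n" using A by simp
    show "(A *\<^sub>v col (poly_mat q A) j) $ i = (z \<cdot>\<^sub>v col (poly_mat q A) j) $ i"
      using arg_cong[OF e, of "\<lambda>M. M $$ (i, j)"] i j A by simp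
  qed (use A in auto)
  then have "eigenvector A (col (poly_mat q A) j) z"
    unfolding eigenvector_def using A v0 j by (auto intro!: col_carrier_vec)
  then show ?thesis by (auto simp: eigenvalue_def)
qed

text \<open>\<open>poly_mat s A\<close> is normal, so its kernel does not grow under squaring and
  the exponent can be lowered one by one.\<close>

lemma normal_cmat_annihilates_power:
  assumes N: "normal_cmat n A" and "annihilates (s ^ Suc k) A"
  shows "annihilates s A"
  using assms(2)
proof (induction k)
  case (Suc k)
  have A: "A \<in> carrier_mat n n" using N by (auto simp: normal_cmat_def)
  have "poly_mat s A * (poly_mat s A * poly_mat (s ^ k) A) = 0\<^sub>m n n"
    using Suc.prems A by (simp add: annihilates_def poly_mat_mult[OF A])
  then have "poly_mat s A * poly_mat (s ^ k) A = 0\<^sub>m n n"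
    by (rule normal_cmat_mult_mult_eq_0[OF normal_cmat_poly_mat[OF N] poly_mat_carrier[OF A]])
  then have "annihilates (s ^ Suc k) A" using A by (simp add: annihilates_def poly_mat_mult[OF A])
  then show ?case by (rule Suc.IH)
qed simp

text \<open>The roots of the minimal polynomial are eigenvalues, so it divides a power of this
  product; normality removes the power.\<close>

lemma normal_cmat_annihilates_spectrum:
  assumes N: "normal_cmat n A"
  shows "annihilates (\<Prod>z\<in>spectrum A. [:- z, 1:]) A"
proof -
  have A: "A \<in> carrier_mat n n" using N by (auto simp: normal_cmat_def)
  define p where "p = minimal_poly A"
  have p: "monic p" "annihilates p A" "p \<noteq> 0" using minimal_poly[OF A] by (auto simp: p_def)
  let ?R = "{z. poly p z = 0}" and ?s = "\<Prod>z\<in>spectrum A. [:- z, 1:]"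
  have R: "?R \<subseteq> spectrum A"
    using minimal_poly_root_eigenvalue[OF A] by (auto simp: p_def spectrum_def)
  have "p = (\<Prod>z\<in>?R. [:- z, 1:] ^ order z p)"
    using complex_poly_decompose[of p] p(1) by simp
  \<comment> \<open>One exponent for all roots: multiplicities are at most \<open>degree p\<close>,
    and \<open>normal_cmat_annihilates_power\<close> takes exponents of the form
    \<open>Suc k\<close>.\<close>
  also have "\<dots> dvd (\<Prod>z\<in>?R. [:- z, 1:] ^ Suc (degree p))"
    by (intro prod_dvd_prod le_imp_power_dvd) (use order_degree[OF p(3)] in \<open>auto intro: le_SucI\<close>)
  also have "\<dots> dvd (\<Prod>z\<in>spectrum A. [:- z, 1:] ^ Suc (degree p))"
    using R card_finite_spectrum(1)[OF A] by (intro prod_dvd_prod_subset) auto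
  also have "\<dots> = ?s ^ Suc (degree p)" by (rule prod_power_distrib[symmetric])
  finally obtain g where g: "?s ^ Suc (degree p) = p * g" by (elim dvdE)
  have "annihilates (?s ^ Suc (degree p)) A"
    unfolding g using p(2) A left_mult_zero_mat[OF poly_mat_carrier[OF A]]
    by (simp add: annihilates_def poly_mat_mult[OF A])
  then show ?thesis by (rule normal_cmat_annihilates_power[OF N])
qed

section \<open>The adjoint of a normal matrix as a polynomial in the matrix\<close>

lemma poly_interpolation:
  fixes f :: "'a :: field \<Rightarrow> 'a"
  assumes "finite S" shows "\<exists>q. \<forall>z\<in>S. poly q z = f z"
  using assms
proof (induction S)
  case (insert x S)
  then obtain q where q: "\<forall>z\<in>S. poly q z = f z" by auto
  let ?s = "\<Prod>z\<in>S. [:- z, 1:]"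
  have s: "poly ?s x \<noteq> 0" "\<forall>z\<in>S. poly ?s z = 0"
    using insert by (auto simp: poly_prod)
  \<comment> \<open>The correction term is a multiple of a product that vanishes on \<open>S\<close>
    but not at the new node \<open>x\<close>.\<close>
  show ?case
    by (rule exI[of _ "q + Polynomial.smult ((f x - poly q x) / poly ?s x) ?s"])
      (use q s in auto)
qed simp

text \<open>\<open>A\<close>, \<open>poly_mat q A\<close> and their adjoints commute pairwise: some
  relations are commutation with polynomials, the others follow by taking adjoints.\<close>

lemma normal_cmat_adjoint_minus_poly:
  assumes N: "normal_cmat n A" shows "normal_cmat n (mat_adjoint A - poly_mat q A)"
proof -
  have A: "A \<in> carrier_mat n n" and AA: "mat_adjoint A * A = A * mat_adjoint A"
    using N by (auto simp: normal_cmat_def)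
  let ?q = "poly_mat q A" and ?a = "mat_adjoint A"
  let ?qa = "mat_adjoint ?q"
  note c = A poly_mat_carrier[OF A, of q] mat_adjoint_carrier[OF A]
    mat_adjoint_carrier[OF poly_mat_carrier[OF A, of q]]
  have qq: "?qa * ?q = ?q * ?qa" using normal_cmat_poly_mat[OF N, of q] by (simp add: normal_cmat_def)
  have 1: "?a * ?q = ?q * ?a" by (rule poly_mat_commute_adjoint[OF N])
  have 2: "A * ?q = ?q * A" by (rule poly_mat_commute[OF A A refl])
  have 3: "?qa * A = A * ?qa"
    using arg_cong[OF 1, of mat_adjoint] c by (simp add: mat_adjoint_mult[of _ n n _ n])
  have 4: "?qa * ?a = ?a * ?qa"
    using arg_cong[OF 2, of mat_adjoint] c by (simp add: mat_adjoint_mult[of _ n n _ n])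
  have "(A - ?qa) * (?a - ?q) = (A * ?a - A * ?q) - (?qa * ?a - ?qa * ?q)"
    unfolding mult_minus_distrib_mat[OF c(1,3,2), symmetric] mult_minus_distrib_mat[OF c(4,3,2), symmetric]
    by (rule minus_mult_distrib_mat[OF c(1,4)]) (use c in \<open>auto simp: minus_carrier_mat\<close>)
  also have "\<dots> = (?a * A - ?a * ?qa) - (?q * A - ?q * ?qa)"
    unfolding AA qq 2 4
    using c by (intro eq_matI) (auto simp del: index_mult_mat(1))
  also have "\<dots> = (?a - ?q) * (A - ?qa)"
    unfolding mult_minus_distrib_mat[OF c(3,1,4), symmetric] mult_minus_distrib_mat[OF c(2,1,4), symmetric]
    by (rule minus_mult_distrib_mat[OF c(3,2), symmetric]) (use c in \<open>auto simp: minus_carrier_mat\<close>)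
  finally show ?thesis using c by (simp add: normal_cmat_def mat_adjoint_diff[of _ n n] minus_carrier_mat)
qed

text \<open>
  Induction on \<open>S\<close>: with \<open>B = A\<^sup>* - q(A)\<close> and \<open>K = B g(A)\<close>, splitting off the factor for \<open>w\<close> gives
  \<open>(A - w) K = 0\<close>. By normality \<open>A\<^sup>* K = cnj w K = q(A) K\<close>, so \<open>B\<^sup>2 g(A) = 0\<close>, and as \<open>B\<close> is normal,
  \<open>B g(A) = 0\<close>.
\<close>

lemma normal_cmat_adjoint_eq_poly_aux:
  assumes N: "normal_cmat n A" and "finite S" and "\<forall>z\<in>S. poly q z = cnj z"
    and "annihilates ((\<Prod>z\<in>S. [:- z, 1:]) * g) A"
  shows "(mat_adjoint A - poly_mat q A) * poly_mat g A = 0\<^sub>m n n"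
  using assms(2-)
proof (induction S arbitrary: g)
  case empty
  then show ?case using N by (auto simp: annihilates_def normal_cmat_def minus_carrier_mat)
next
  case (insert w S)
  have A: "A \<in> carrier_mat n n" using N by (auto simp: normal_cmat_def)
  define X where "X = poly_mat [:- w, 1:] A"
  define B where "B = mat_adjoint A - poly_mat q A"
  define G where "G = poly_mat g A"
  define K where "K = B * G"
  have c [simp]: "X \<in> carrier_mat n n" "B \<in> carrier_mat n n" "G \<in> carrier_mat n n" "K \<in> carrier_mat n n"
    using A by (auto simp: X_def B_def G_def K_def minus_carrier_mat)
  have NB: "normal_cmat n B" unfolding B_def by (rule normal_cmat_adjoint_minus_poly[OF N])
  have NX: "normal_cmat n X" unfolding X_def by (rule normal_cmat_poly_mat[OF N])
  have XB: "B * X = X * B"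
  proof -
    have "B * X = mat_adjoint A * X - poly_mat q A * X"
      unfolding B_def by (rule minus_mult_distrib_mat[of _ n n _ _ n]) (use A in \<open>auto simp: X_def\<close>)
    also have "\<dots> = X * mat_adjoint A - X * poly_mat q A"
      unfolding X_def by (simp add: poly_mat_commute_adjoint[OF N] poly_mat_mult[OF A, symmetric] mult.commute)
    also have "\<dots> = X * B"
      unfolding B_def by (rule mult_minus_distrib_mat[of _ n n _ n, symmetric]) (use A in \<open>auto simp: X_def\<close>)
    finally show ?thesis .
  qed
  have "annihilates ((\<Prod>z\<in>S. [:- z, 1:]) * ([:- w, 1:] * g)) A"
    using insert.prems(2) by (simp only: prod.insert[OF insert.hyps] mult_ac)
  then have "B * poly_mat ([:- w, 1:] * g) A = 0\<^sub>m n n"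
    unfolding B_def using insert.prems(1) by (intro insert.IH) auto
  then have z: "B * (X * G) = 0\<^sub>m n n" by (simp only: poly_mat_mult[OF A] X_def G_def)
  have XK: "X * K = 0\<^sub>m n n"
  proof -
    have "X * K = X * B * G" unfolding K_def by (rule assoc_mult_mat[of _ n n _ n _ n, symmetric]) auto
    also have "\<dots> = B * (X * G)" unfolding XB[symmetric] by (rule assoc_mult_mat[of _ n n _ n _ n]) auto
    finally show ?thesis using z by simp
  qed
  have aX: "mat_adjoint X = mat_adjoint A - cnj w \<cdot>\<^sub>m 1\<^sub>m n"
    unfolding X_def poly_mat_linear[OF A] using A by (intro eq_matI) auto
  have smK: "(a \<cdot>\<^sub>m 1\<^sub>m n) * K = a \<cdot>\<^sub>m K" for a
    using mult_smult_assoc_mat[OF one_carrier_mat c(4), of a] left_mult_one_mat[OF c(4)] by simp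
  have "0\<^sub>m n n = (mat_adjoint A - cnj w \<cdot>\<^sub>m 1\<^sub>m n) * K"
    unfolding aX[symmetric] by (rule normal_cmat_adjoint_mult_eq_0[OF NX c(4) XK, symmetric])
  also have "\<dots> = mat_adjoint A * K - cnj w \<cdot>\<^sub>m K"
    unfolding smK[symmetric] by (rule minus_mult_distrib_mat[of _ n n _ _ n]) (use A in auto)
  finally have e1: "mat_adjoint A * K - cnj w \<cdot>\<^sub>m K = 0\<^sub>m n n" by simp
  \<comment> \<open>\<open>q\<close> takes the value \<open>cnj w\<close> at \<open>w\<close>. As
    \<open>X\<close> kills \<open>K\<close>, the quotient \<open>h\<close> contributes nothing to
    \<open>poly_mat q A * K\<close>.\<close>
  have "[:- w, 1:] dvd q - [:cnj w:]" using insert.prems(1) by (simp add: poly_eq_0_iff_dvd[symmetric])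
  then obtain h where "q - [:cnj w:] = [:- w, 1:] * h" by (elim dvdE)
  then have h: "q = [:cnj w:] + h * [:- w, 1:]" by (metis add.commute diff_add_cancel mult.commute)
  have "poly_mat q A * K = (cnj w \<cdot>\<^sub>m 1\<^sub>m n) * K + (poly_mat h A * X) * K"
    unfolding h poly_mat_add[OF A] poly_mat_mult[OF A] poly_mat_const[OF A] X_def[symmetric]
    by (rule add_mult_distrib_mat[of _ n n _ _ n])
      (use A in \<open>auto intro: mult_carrier_mat[OF poly_mat_carrier[OF A] c(1)]\<close>)
  also have "poly_mat h A * X * K = poly_mat h A * (X * K)"
    by (rule assoc_mult_mat[of _ n n _ n _ n]) (use A in auto)
  also have "\<dots> = 0\<^sub>m n n" unfolding XK using right_mult_zero_mat[OF poly_mat_carrier[OF A]] by simp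
  finally have e2: "poly_mat q A * K = cnj w \<cdot>\<^sub>m K" unfolding smK by simp
  have "B * K = mat_adjoint A * K - poly_mat q A * K"
    unfolding B_def by (rule minus_mult_distrib_mat[of _ n n _ _ n]) (use A in auto)
  then have "B * (B * G) = 0\<^sub>m n n" unfolding e2 e1 by (simp add: K_def)
  then show ?case unfolding B_def[symmetric] G_def[symmetric]
    by (rule normal_cmat_mult_mult_eq_0[OF NB c(3)])
qed

text \<open>Let \<open>q\<close> interpolate conjugation on the spectrum and apply the auxiliary
  lemma to the whole spectrum with \<open>g = 1\<close>.\<close>

lemma normal_cmat_adjoint_eq_poly:
  assumes N: "normal_cmat n A" shows "\<exists>q. mat_adjoint A = poly_mat q A"
proof -
  have A: "A \<in> carrier_mat n n" using N by (auto simp: normal_cmat_def)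
  have fin: "finite (spectrum A)" by (rule card_finite_spectrum(1)[OF A])
  obtain q where q: "\<forall>z\<in>spectrum A. poly q z = cnj z" using poly_interpolation[OF fin, of cnj] by blast
  have "(mat_adjoint A - poly_mat q A) * poly_mat 1 A = 0\<^sub>m n n"
    by (rule normal_cmat_adjoint_eq_poly_aux[OF N fin q]) (simp add: normal_cmat_annihilates_spectrum[OF N])
  then have z: "mat_adjoint A - poly_mat q A = 0\<^sub>m n n"
    using A right_mult_one_mat[of "mat_adjoint A - poly_mat q A" n n] by (simp add: minus_carrier_mat)
  have "mat_adjoint A = poly_mat q A"
  proof (rule eq_matI)
    fix i j assume "i < dim_row (poly_mat q A)" "j < dim_col (poly_mat q A)"
    then show "mat_adjoint A $$ (i, j) = poly_mat q A $$ (i, j)"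
      using arg_cong[OF z, of "\<lambda>M. M $$ (i, j)"] A by auto
  qed (use A in auto)
  then show ?thesis ..
qed

subsection \<open>Real matrices\<close>

lemma complex_mat_carrier [simp]: "complex_mat A \<in> carrier_mat n m \<longleftrightarrow> A \<in> carrier_mat n m"
  unfolding complex_mat_def by (rule map_carrier_mat)

text \<open>Powers of a real matrix are real, so taking real parts acts on the coefficients
  alone.\<close>

lemma poly_mat_complex_Re:
  assumes A: "A \<in> carrier_mat n n" and ij: "i < n" "j < n"
  shows "Re (poly_mat p (complex_mat A) $$ (i, j)) = poly_mat (map_poly Re p) A $$ (i, j)"
proof -
  have "complex_mat A ^\<^sub>m k = complex_mat (A ^\<^sub>m k)" for k
    unfolding complex_mat_def by (rule of_real_hom.mat_hom_pow[OF A, symmetric])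
  moreover have "degree (map_poly Re p) \<le> degree p" by (simp add: degree_map_poly_le)
  ultimately show ?thesis
    using poly_mat_index_le[OF A ij, of "map_poly Re p" "degree p"]
      poly_mat_index_le[of "complex_mat A" n i j p "degree p"] A ij pow_carrier_mat[OF A]
    by (auto simp: coeff_map_poly complex_mat_def)
qed

lemma annihilates_Re:
  assumes A: "A \<in> carrier_mat n n" and "annihilates p (complex_mat A)"
  shows "annihilates (map_poly Re p) A"
proof -
  have "poly_mat (map_poly Re p) A = 0\<^sub>m n n"
  proof (rule eq_matI)
    fix i j assume "i < dim_row (0\<^sub>m n n)" "j < dim_col (0\<^sub>m n n)"
    then have ij: "i < n" "j < n" by auto
    show "poly_mat (map_poly Re p) A $$ (i, j) = 0\<^sub>m n n $$ (i, j)"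
      using poly_mat_complex_Re[OF A ij, of p] assms(2) ij A
      by (simp add: annihilates_def complex_mat_def)
  qed (use A in auto)
  then show ?thesis using A by (simp add: annihilates_def)
qed

lemma poly_mat_of_real:
  assumes A: "A \<in> carrier_mat n n" and ij: "i < n" "j < n"
  shows "poly_mat (map_poly complex_of_real p) (complex_mat A) $$ (i, j)
    = complex_of_real (poly_mat p A $$ (i, j))"
proof -
  have "complex_mat A ^\<^sub>m k = complex_mat (A ^\<^sub>m k)" for k
    unfolding complex_mat_def by (rule of_real_hom.mat_hom_pow[OF A, symmetric])
  then show ?thesis
    using poly_mat_index_le[OF A ij, of p "degree p"]
      poly_mat_index_le[of "complex_mat A" n i j "map_poly complex_of_real p" "degree p"] A ij pow_carrier_mat[OF A]
    by (auto simp: coeff_map_poly complex_mat_def)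
qed

lemma card_spectrum_le_degree_real:
  assumes A: "A \<in> carrier_mat n n" and "annihilates p A" "p \<noteq> 0"
  shows "card (spectrum (complex_mat A)) \<le> degree p"
proof -
  have "annihilates (map_poly complex_of_real p) (complex_mat A)"
    using assms unfolding annihilates_def
    by (intro eq_matI) (auto simp: complex_mat_def poly_mat_of_real[OF A, unfolded complex_mat_def])
  then have "card (spectrum (complex_mat A)) \<le> degree (map_poly complex_of_real p)"
    by (rule card_spectrum_le_degree[of _ n, rotated]) (use assms in auto)
  then show ?thesis by simp
qed

lemma normal_cmat_complex_mat:
  assumes A: "A \<in> carrier_mat n n" and "normal_mat A"
  shows "normal_cmat n (complex_mat A)"
proof -
  have adj: "mat_adjoint (complex_mat A) = complex_mat (transpose_mat A)"
    using A by (intro eq_matI) (auto simp: complex_mat_def)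
  have "complex_mat (transpose_mat A) * complex_mat A = complex_mat (transpose_mat A * A)"
    using A unfolding complex_mat_def by (intro of_real_hom.mat_hom_mult[symmetric, of _ n n _ n]) auto
  also have "\<dots> = complex_mat (A * transpose_mat A)" using assms by (simp add: normal_mat_def)
  also have "\<dots> = complex_mat A * complex_mat (transpose_mat A)"
    using A unfolding complex_mat_def by (intro of_real_hom.mat_hom_mult[of _ n n _ n]) auto
  finally show ?thesis using A by (simp add: normal_cmat_def adj)
qed

lemma normal_mat_transpose_eq_poly:
  assumes A: "A \<in> carrier_mat n n" and "normal_mat A"
  shows "\<exists>q. transpose_mat A = poly_mat q A"
proof -
  obtain q where q: "mat_adjoint (complex_mat A) = poly_mat q (complex_mat A)"
    using normal_cmat_adjoint_eq_poly[OF normal_cmat_complex_mat[OF assms]] by blast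
  have "transpose_mat A = poly_mat (map_poly Re q) A"
  proof (rule eq_matI)
    fix i j assume "i < dim_row (poly_mat (map_poly Re q) A)" "j < dim_col (poly_mat (map_poly Re q) A)"
    then have ij: "i < n" "j < n" using A by auto
    show "transpose_mat A $$ (i, j) = poly_mat (map_poly Re q) A $$ (i, j)"
      using arg_cong[OF q, of "\<lambda>M. Re (M $$ (i, j))"] poly_mat_complex_Re[OF A ij, of q] ij A
      by (auto simp: complex_mat_def)
  qed (use A in auto)
  then show ?thesis ..
qed

text \<open>The witness has the real parts of the coefficients of the product over the spectrum. The
  leading coefficient 1 survives, so the degree does not drop.\<close>

lemma normal_mat_ex_annihilating:
  assumes A: "A \<in> carrier_mat n n" and "normal_mat A"
  shows "\<exists>m. monic m \<and> degree m = card (spectrum (complex_mat A)) \<and> annihilates m A"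
proof -
  let ?S = "spectrum (complex_mat A)"
  let ?s = "\<Prod>z\<in>?S. [:- z, 1:]"
  have ds: "degree ?s = card ?S" by (simp add: degree_prod_eq_sum_degree)
  have "monic ?s" by (rule monic_prod) simp
  then have 1: "coeff (map_poly Re ?s) (card ?S) = 1" using ds by (simp add: coeff_map_poly)
  have "degree (map_poly Re ?s) \<le> card ?S" using degree_map_poly_le[of Re ?s] ds by simp
  then have "degree (map_poly Re ?s) = card ?S" using 1 le_degree[of "map_poly Re ?s" "card ?S"] by simp
  moreover have "annihilates (map_poly Re ?s) A"
    by (rule annihilates_Re[OF A normal_cmat_annihilates_spectrum[OF normal_cmat_complex_mat[OF assms]]])
  ultimately show ?thesis using 1 by (intro exI[of _ "map_poly Re ?s"]) simp
qed

section \<open>Predistance polynomials\<close>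

text \<open>The adjoint of a real matrix is its transpose, so the trace is the entrywise inner
  product.\<close>

lemma poly_inner_eq:
  assumes A: "A \<in> carrier_mat n n"
  shows "poly_inner A f g = (\<Sum>i<n. \<Sum>j<n. poly_mat f A $$ (i, j) * poly_mat g A $$ (i, j)) / real n"
  using A by (simp add: poly_inner_def mat_trace_def times_mat_def scalar_prod_def atLeast0LessThan)

locale real_mat =
  fixes n :: nat and A :: "real mat" and d :: nat
  assumes A: "A \<in> carrier_mat n n" and n_pos: "0 < n"
    and spectrum: "card (spectrum (complex_mat A)) = d + 1"
begin

abbreviation "ip \<equiv> poly_inner A"
abbreviation "P \<equiv> predistance_poly A"
abbreviation "en f i j \<equiv> poly_mat f A $$ (i, j)"

lemma ip_commute: "ip f g = ip g f"
  by (simp add: poly_inner_eq[OF A] mult.commute)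

lemma ip_add: "ip (f + g) h = ip f h + ip g h"
  by (simp add: poly_inner_eq[OF A] poly_mat_index_add[OF A] distrib_right sum.distrib add_divide_distrib)

lemma ip_smult: "ip (Polynomial.smult c f) h = c * ip f h"
  by (simp add: poly_inner_eq[OF A] poly_mat_index_smult[OF A] sum_distrib_left mult.assoc)

lemma ip_diff: "ip (f - g) h = ip f h - ip g h"
  using ip_add[of "f - g" g h] by simp

lemma ip_0 [simp]: "ip 0 h = 0"
  using ip_smult[of 0 0 h] by simp

lemma ip_sum: "ip (sum f I) h = (\<Sum>i\<in>I. ip (f i) h)"
  by (induction I rule: infinite_finite_induct) (auto simp: ip_add)

lemma ip_nonneg: "0 \<le> ip f f"
  by (auto simp: poly_inner_eq[OF A] intro!: divide_nonneg_nonneg sum_nonneg)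

text \<open>If the norm were zero, every entry of \<open>poly_mat f A\<close> would vanish; but a
  nonzero annihilating polynomial has degree at least \<open>d + 1\<close>.\<close>

lemma ip_pos:
  assumes "f \<noteq> 0" "degree f \<le> d" shows "0 < ip f f"
proof (rule ccontr)
  assume "\<not> 0 < ip f f"
  then have "(\<Sum>i<n. \<Sum>j<n. en f i j * en f i j) = 0"
    using ip_nonneg[of f] n_pos by (simp add: poly_inner_eq[OF A])
  then have "en f i j = 0" if "i < n" "j < n" for i j
    using that by (subst (asm) sum_nonneg_eq_0_iff; (simp add: sum_nonneg)?)
      (simp add: sum_nonneg_eq_0_iff)
  then have "annihilates f A" unfolding annihilates_def using A by (intro eq_matI) auto
  then have "d + 1 \<le> degree f"
    using card_spectrum_le_degree_real[OF A _ assms(1)] spectrum by simp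
  then show False using assms(2) by simp
qed

lemma coeff_predistance: "coeff (P k) k = 1" "m > k \<Longrightarrow> coeff (P k) m = 0"
proof (induction k arbitrary: m rule: less_induct)
  case (less k)
  have z: "coeff (\<Sum>i<k. Polynomial.smult (c i) (P i)) m = 0" if "m \<ge> k" for c m
    unfolding coeff_sum using less(2) that by (intro sum.neutral) auto
  { case 1 show ?case by (subst predistance_poly.simps) (simp add: z) }
  { case 2 then show ?case by (subst predistance_poly.simps) (simp add: z) }
qed

lemma degree_predistance [simp]: "degree (P k) = k"
  using coeff_predistance[of k] by (metis le_degree le_antisym degree_le one_neq_zero)

lemma predistance_neq_0 [simp]: "P k \<noteq> 0"
  using coeff_predistance(1)[of k] by auto

lemma predistance_norm_pos: "k \<le> d \<Longrightarrow> 0 < ip (P k) (P k)"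
  by (rule ip_pos) auto

lemma predistance_orth_less: "j < k \<Longrightarrow> k \<le> d \<Longrightarrow> ip (P k) (P j) = 0"
proof (induction k arbitrary: j rule: less_induct)
  case (less k)
  have o: "ip (P i) (P j) = 0" if "i < k" "i \<noteq> j" for i
  proof (cases "i < j")
    case True
    then show ?thesis using less.IH[of j i] less.prems by (simp add: ip_commute)
  next
    case False
    then show ?thesis using less.IH[of i j] less.prems that by simp
  qed
  let ?c = "\<lambda>i. ip (monom 1 k) (P i) / ip (P i) (P i)"
  have "ip (P k) (P j) = ip (monom 1 k) (P j) - (\<Sum>i<k. ?c i * ip (P i) (P j))"
    by (subst predistance_poly.simps) (simp add: ip_diff ip_sum ip_smult)
  \<comment> \<open>Only \<open>i = j\<close> survives, and there the denominator cancels because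
    \<open>P j\<close> has positive norm.\<close>
  also have "(\<Sum>i<k. ?c i * ip (P i) (P j)) = (\<Sum>i<k. if i = j then ip (monom 1 k) (P j) else 0)"
    using o predistance_norm_pos[of j] less.prems by (intro sum.cong refl) auto
  also have "\<dots> = ip (monom 1 k) (P j)" using less.prems by simp
  finally show ?case by simp
qed

lemma predistance_orth: "j \<noteq> k \<Longrightarrow> k \<le> d \<Longrightarrow> j \<le> d \<Longrightarrow> ip (P k) (P j) = 0"
  using predistance_orth_less[of j k] predistance_orth_less[of k j] ip_commute[of "P k" "P j"]
  by (cases "j < k") auto

text \<open>The hypothesis is on coefficients rather than on the degree, so that
  \<open>k = 0\<close> means \<open>f = 0\<close>. Subtracting \<open>coeff f k\<close> times the
  monic \<open>P k\<close> removes the top coefficient.\<close>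

lemma predistance_span:
  "(\<forall>m\<ge>k. coeff f m = 0) \<Longrightarrow> \<exists>c. f = (\<Sum>i<k. Polynomial.smult (c i) (P i))"
proof (induction k arbitrary: f)
  case 0
  then have "f = 0" by (intro poly_eqI) auto
  then show ?case by simp
next
  case (Suc k)
  let ?g = "f - Polynomial.smult (coeff f k) (P k)"
  have "coeff ?g m = 0" if "m \<ge> k" for m
  proof (cases "m = k")
    case True
    then show ?thesis by (simp add: coeff_predistance)
  next
    case False
    then have "m \<ge> Suc k" using that by simp
    then show ?thesis using Suc.prems by (simp add: coeff_predistance)
  qed
  then obtain c where c: "?g = (\<Sum>i<k. Polynomial.smult (c i) (P i))" using Suc.IH[of ?g] by blast
  have "(\<Sum>i<k. Polynomial.smult ((c(k := coeff f k)) i) (P i)) = ?g"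
    unfolding c by (rule sum.cong) simp_all
  then have "f = (\<Sum>i<Suc k. Polynomial.smult ((c(k := coeff f k)) i) (P i))"
    by (simp only: sum.lessThan_Suc fun_upd_same diff_add_cancel)
  then show ?case by (rule exI[of _ "c(k := coeff f k)"])
qed

lemma predistance_orth_poly:
  assumes "degree f < k" "k \<le> d" shows "ip (P k) f = 0"
proof -
  obtain c where c: "f = (\<Sum>i<k. Polynomial.smult (c i) (P i))"
    using predistance_span[of k f] assms by (auto simp: coeff_eq_0)
  have "ip f (P k) = 0"
    unfolding c ip_sum ip_smult using assms by (intro sum.neutral) (auto simp: predistance_orth)
  then show ?thesis by (simp add: ip_commute)
qed

lemma predistance_expansion:
  assumes "degree f \<le> d"
  shows "f = (\<Sum>i\<le>d. Polynomial.smult (ip f (P i) / ip (P i) (P i)) (P i))"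
proof -
  obtain c where c: "f = (\<Sum>i<Suc d. Polynomial.smult (c i) (P i))"
    using predistance_span[of "Suc d" f] assms by (auto simp: coeff_eq_0)
  have "ip f (P j) / ip (P j) (P j) = c j" if j: "j \<le> d" for j
  proof -
    have "ip f (P j) = (\<Sum>i<Suc d. c i * ip (P i) (P j))"
      by (subst c) (simp only: ip_sum ip_smult)
    also have "\<dots> = (\<Sum>i<Suc d. if i = j then c j * ip (P j) (P j) else 0)"
      using j by (intro sum.cong refl) (auto simp: predistance_orth)
    also have "\<dots> = c j * ip (P j) (P j)" using j by (subst sum.delta) auto
    finally show ?thesis using predistance_norm_pos[OF j] by simp
  qed
  then show ?thesis by (subst c) (simp add: lessThan_Suc_atMost)
qed

end

locale normal_real_mat = real_mat +
  assumes normal: "normal_mat A"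
begin

text \<open>\<open>g\<close> is the remainder modulo the annihilating polynomial of degree
  \<open>d + 1\<close> that normality provides.\<close>

lemma poly_mat_reduce: "\<exists>g. degree g \<le> d \<and> poly_mat g A = poly_mat f A"
proof -
  obtain m where m: "monic m" "degree m = d + 1" "annihilates m A"
    using normal_mat_ex_annihilating[OF A normal] spectrum by auto
  have m0: "m \<noteq> 0" using m by auto
  have "f = f div m * m + f mod m" by simp
  then have "poly_mat f A = poly_mat (f div m * m) A + poly_mat (f mod m) A"
    by (metis poly_mat_add[OF A])
  also have "poly_mat (f div m * m) A = 0\<^sub>m n n"
    unfolding poly_mat_mult[OF A] using m(3) A right_mult_zero_mat[OF poly_mat_carrier[OF A]]
    by (simp add: annihilates_def)
  finally have "poly_mat (f mod m) A = poly_mat f A" using A by simp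
  moreover have "degree (f mod m) < degree m" using degree_mod_less[OF m0, of f] m by auto
  ultimately show ?thesis using m(2) by (intro exI[of _ "f mod m"]) simp
qed

end

section \<open>The Hoffman polynomial of a regular matrix\<close>

lemma index_mult_sum:
  assumes "X \<in> carrier_mat n n" "Y \<in> carrier_mat n n" "i < n" "j < n"
  shows "(X * Y) $$ (i, j) = (\<Sum>l<n. X $$ (i, l) * Y $$ (l, j))"
  using assms by (auto simp: times_mat_def scalar_prod_def atLeast0LessThan)

lemma pow_mat_transpose:
  fixes A :: "real mat"
  assumes "A \<in> carrier_mat n n"
  shows "transpose_mat A ^\<^sub>m k = transpose_mat (A ^\<^sub>m k)"
proof (induction k)
  case (Suc k)
  have "transpose_mat A ^\<^sub>m Suc k = transpose_mat (A ^\<^sub>m k) * transpose_mat A"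
    using Suc by simp
  also have "\<dots> = transpose_mat (A * A ^\<^sub>m k)"
    by (rule transpose_mult[symmetric, of _ n n _ n]) (use assms in auto)
  finally show ?case by (simp only: pow_mat_Suc_left[OF assms])
qed (use assms in simp)

lemma pow_mat_nonneg:
  fixes B :: "real mat"
  assumes B: "B \<in> carrier_mat n n" and nn: "\<And>i j. i < n \<Longrightarrow> j < n \<Longrightarrow> 0 \<le> B $$ (i, j)"
    and "i < n" "j < n"
  shows "0 \<le> (B ^\<^sub>m k) $$ (i, j)"
  using assms(3,4)
proof (induction k arbitrary: i j)
  case (Suc k)
  have "(B ^\<^sub>m Suc k) $$ (i, j) = (\<Sum>l<n. (B ^\<^sub>m k) $$ (i, l) * B $$ (l, j))"
    using index_mult_sum[OF pow_carrier_mat[OF B] B Suc.prems, of k] by simp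
  then show ?case using Suc nn by (auto intro!: sum_nonneg mult_nonneg_nonneg)
qed (use B in auto)

lemma pow_mat_eigen_sum:
  fixes B :: "real mat"
  assumes B: "B \<in> carrier_mat n n" and ev: "\<And>i. i < n \<Longrightarrow> (\<Sum>j<n. B $$ (i, j) * x j) = r * x i"
    and "i < n"
  shows "(\<Sum>j<n. (B ^\<^sub>m k) $$ (i, j) * x j) = r ^ k * x i"
  using assms(3)
proof (induction k arbitrary: i)
  case 0
  have "(\<Sum>j<n. (1\<^sub>m n) $$ (i, j) * x j) = (\<Sum>j<n. if i = j then x j else 0)"
    using 0 by (intro sum.cong) auto
  then show ?case using 0 B by simp
next
  case (Suc k)
  have "(\<Sum>j<n. (B ^\<^sub>m Suc k) $$ (i, j) * x j)
      = (\<Sum>j<n. (\<Sum>l<n. (B ^\<^sub>m k) $$ (i, l) * B $$ (l, j)) * x j)"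
    using index_mult_sum[OF pow_carrier_mat[OF B] B Suc.prems, of _ k] by simp
  also have "\<dots> = (\<Sum>l<n. (B ^\<^sub>m k) $$ (i, l) * (\<Sum>j<n. B $$ (l, j) * x j))"
    by (simp add: sum_distrib_left sum_distrib_right mult.assoc) (rule sum.swap)
  also have "\<dots> = (\<Sum>l<n. (B ^\<^sub>m k) $$ (i, l) * (r * x l))"
    by (simp add: ev)
  also have "\<dots> = r * (\<Sum>l<n. (B ^\<^sub>m k) $$ (i, l) * x l)"
    by (simp add: sum_distrib_left mult_ac)
  finally show ?case using Suc by simp
qed

text \<open>At a maximal entry of \<open>x\<close>, the average \<open>r\<^sup>k x = B\<^sup>k x\<close> forces all reached entries to be maximal.\<close>

lemma regular_eigenvector_constant:
  fixes B :: "real mat"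
  assumes B: "B \<in> carrier_mat n n" and nn: "\<And>i j. i < n \<Longrightarrow> j < n \<Longrightarrow> 0 \<le> B $$ (i, j)"
    and reach: "\<And>i j. i < n \<Longrightarrow> j < n \<Longrightarrow> \<exists>k. 0 < (B ^\<^sub>m k) $$ (i, j)"
    and rs: "\<And>i. i < n \<Longrightarrow> (\<Sum>j<n. B $$ (i, j)) = r"
    and ev: "\<And>i. i < n \<Longrightarrow> (\<Sum>j<n. B $$ (i, j) * x j) = r * x i"
    and ij: "i < n" "j < n"
  shows "x i = x j"
proof -
  let ?m = "Max (x ` {..<n})"
  have "?m \<in> x ` {..<n}" using ij by (intro Max_in) auto
  then obtain a where a: "a < n" "x a = ?m" by auto
  have le: "x l \<le> x a" if "l < n" for l unfolding a(2) using that by (intro Max_ge) auto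
  have "x l = x a" if l: "l < n" for l
  proof -
    obtain k where k: "0 < (B ^\<^sub>m k) $$ (a, l)" using reach[OF a(1) l] by blast
    \<comment> \<open>A sum of nonnegative terms, and a difference of two numbers that both equal
      \<open>r ^ k * x a\<close>, by \<open>pow_mat_eigen_sum\<close> for the constant 1 and for
      \<open>x\<close>.\<close>
    have "(\<Sum>j<n. (B ^\<^sub>m k) $$ (a, j) * (x a - x j))
        = (\<Sum>j<n. (B ^\<^sub>m k) $$ (a, j) * 1) * x a - (\<Sum>j<n. (B ^\<^sub>m k) $$ (a, j) * x j)"
      by (simp add: right_diff_distrib sum_subtractf sum_distrib_right)
    also have "\<dots> = 0"
      using pow_mat_eigen_sum[OF B, of "\<lambda>_. 1" r a k] pow_mat_eigen_sum[OF B ev a(1), of k] rs a by simp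
    finally have "(B ^\<^sub>m k) $$ (a, l) * (x a - x l) = 0"
      using l le pow_mat_nonneg[OF B nn a(1)] by (subst (asm) sum_nonneg_eq_0_iff) auto
    then show ?thesis using k by simp
  qed
  then show ?thesis using ij by simp
qed

section \<open>The Perron eigenvalue and the Hoffman matrix in the regular case\<close>

context real_mat
begin

lemma en_mult: "i < n \<Longrightarrow> j < n \<Longrightarrow> en (f * g) i j = (\<Sum>l<n. en f i l * en g l j)"
  unfolding poly_mat_mult[OF A] by (rule index_mult_sum) (use A in auto)

lemma en_linear: "i < n \<Longrightarrow> j < n \<Longrightarrow> en [:- c, 1:] i j = A $$ (i, j) - (if i = j then c else 0)"
  unfolding poly_mat_linear[OF A] using A by auto

text \<open>Over any field, since it is applied both to \<open>A\<close> and to its complex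
  version.\<close>

lemma ones_eigenvector:
  fixes B :: "'b :: field mat"
  assumes "B \<in> carrier_mat n n" "\<And>i. i < n \<Longrightarrow> (\<Sum>j<n. B $$ (i, j)) = c"
  shows "eigenvector B (vec n (\<lambda>_. 1)) c"
proof -
  have "vec n (\<lambda>_. 1 :: 'b) \<noteq> 0\<^sub>v n"
  proof
    assume "vec n (\<lambda>_. 1 :: 'b) = 0\<^sub>v n"
    from arg_cong[OF this, of "\<lambda>v. v $ 0"] show False using n_pos by simp
  qed
  moreover have "B *\<^sub>v vec n (\<lambda>_. 1) = c \<cdot>\<^sub>v vec n (\<lambda>_. 1)"
    using assms by (intro eq_vecI) (auto simp: scalar_prod_def atLeast0LessThan)
  ultimately show ?thesis using assms(1) by (simp add: eigenvector_def)
qed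

text \<open>The all-ones vector has eigenvalue \<open>r\<close>. For any other eigenvector, the
  triangle inequality in a row where its entry has maximal modulus bounds the eigenvalue by the row
  sum \<open>r\<close>.\<close>

lemma perron_regular:
  assumes nn: "\<And>i j. i < n \<Longrightarrow> j < n \<Longrightarrow> 0 \<le> A $$ (i, j)"
    and rs: "\<And>i. i < n \<Longrightarrow> (\<Sum>j<n. A $$ (i, j)) = r"
  shows "perron_eigenvalue A = r"
proof -
  have r0: "0 \<le> r" unfolding rs[OF n_pos, symmetric] using nn n_pos by (intro sum_nonneg) auto
  have "(\<Sum>j<n. complex_mat A $$ (i, j)) = complex_of_real r" if "i < n" for i
    using that A unfolding rs[OF that, symmetric] by (simp add: complex_mat_def)
  then have evC: "eigenvalue (complex_mat A) (complex_of_real r)"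
    unfolding eigenvalue_def using ones_eigenvector[of "complex_mat A" "complex_of_real r"] A by auto
  have bound: "cmod \<mu> \<le> r" if "eigenvalue (complex_mat A) \<mu>" for \<mu>
  proof -
    obtain v where v: "v \<in> carrier_vec n" "v \<noteq> 0\<^sub>v n" "complex_mat A *\<^sub>v v = \<mu> \<cdot>\<^sub>v v"
      using \<open>eigenvalue (complex_mat A) \<mu>\<close> A by (auto simp: eigenvalue_def eigenvector_def complex_mat_def)
    let ?x = "\<lambda>i. cmod (v $ i)"
    let ?m = "Max (?x ` {..<n})"
    have "?m \<in> ?x ` {..<n}" using n_pos by (intro Max_in) auto
    then obtain a where a: "a < n" "?x a = ?m" by auto
    have le: "?x l \<le> ?x a" if "l < n" for l unfolding a(2) using that by (intro Max_ge) auto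
    have "?x a > 0"
    proof (rule ccontr)
      assume "\<not> ?x a > 0"
      then have "v $ l = 0" if "l < n" for l using le[OF that] by simp
      then have "v = 0\<^sub>v n" using v(1) by (intro eq_vecI) auto
      then show False using v(2) by simp
    qed
    moreover have "cmod \<mu> * ?x a \<le> r * ?x a"
    proof -
      have "\<mu> * v $ a = (\<mu> \<cdot>\<^sub>v v) $ a" using v(1) a by simp
      also have "\<dots> = (\<Sum>j<n. complex_of_real (A $$ (a, j)) * v $ j)"
        unfolding v(3)[symmetric] using v(1) a A
        by (auto simp: complex_mat_def scalar_prod_def atLeast0LessThan)
      finally have "cmod \<mu> * ?x a = cmod (\<Sum>j<n. complex_of_real (A $$ (a, j)) * v $ j)"
        by (metis norm_mult)
      also have "\<dots> \<le> (\<Sum>j<n. cmod (complex_of_real (A $$ (a, j)) * v $ j))" by (rule norm_sum)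
      also have "\<dots> \<le> (\<Sum>j<n. A $$ (a, j) * ?x a)"
        using nn a le by (intro sum_mono) (auto simp: norm_mult intro!: mult_left_mono)
      finally show ?thesis using rs[OF a(1)] by (simp add: sum_distrib_right[symmetric])
    qed
    ultimately show ?thesis by simp
  qed
  show ?thesis
    unfolding perron_eigenvalue_def
  proof (rule the_equality)
    \<comment> \<open>Each of \<open>r\<close> and \<open>r'\<close> bounds the modulus of the
      other, and \<open>r\<close> is nonnegative.\<close>
    fix r' assume r': "eigenvalue (complex_mat A) (complex_of_real r') \<and>
      (\<forall>\<mu>. eigenvalue (complex_mat A) \<mu> \<longrightarrow> cmod \<mu> \<le> r')"
    then have "cmod (complex_of_real r) \<le> r'" using evC by blast
    moreover have "cmod (complex_of_real r') \<le> r" using r' bound by blast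
    ultimately have "\<bar>r\<bar> \<le> r'" "\<bar>r'\<bar> \<le> r" by simp_all
    then show "r' = r" using r0 by simp
  qed (use evC bound in auto)
qed

text \<open>With minimal polynomial \<open>[:- r, 1:] * S\<close>, the columns of
  \<open>poly_mat S A\<close> are eigenvectors of \<open>A\<close> for \<open>r\<close>, and its
  rows are eigenvectors of the transpose. Connectivity makes both constant, so all entries equal one
  \<open>c\<close>, and the scaling in \<open>hoffman_poly\<close> turns \<open>c\<close> into
  1.\<close>

lemma hoffman_regular:
  assumes nn: "\<And>i j. i < n \<Longrightarrow> j < n \<Longrightarrow> 0 \<le> A $$ (i, j)"
    and reach: "\<And>i j. i < n \<Longrightarrow> j < n \<Longrightarrow> \<exists>k. 0 < (A ^\<^sub>m k) $$ (i, j)"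
    and rs: "\<And>i. i < n \<Longrightarrow> (\<Sum>j<n. A $$ (i, j)) = r"
    and cs: "\<And>j. j < n \<Longrightarrow> (\<Sum>i<n. A $$ (i, j)) = r"
    and ij: "i < n" "j < n"
  shows "en (hoffman_poly A) i j = 1"
proof -
  have perron: "perron_eigenvalue A = r" by (rule perron_regular[OF nn rs])
  have evA: "eigenvector A (vec n (\<lambda>_. 1)) r" by (rule ones_eigenvector[OF A rs])
  define S where "S = minimal_poly A div [:- r, 1:]"
  have "poly (minimal_poly A) r = 0"
    using annihilates_eigenvalue[OF A minimal_poly(2)[OF A]] evA by (auto simp: eigenvalue_def)
  then have mS: "minimal_poly A = [:- r, 1:] * S"
    unfolding S_def poly_eq_0_iff_dvd by (metis dvd_mult_div_cancel)
  have m0: "minimal_poly A \<noteq> 0" using minimal_poly(1)[OF A] by auto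
  then have S0: "S \<noteq> 0" using mS by auto
  have "degree S < degree (minimal_poly A)"
    unfolding mS using S0 degree_mult_eq[of "[:- r, 1:]" S] by simp
  then have na: "\<not> annihilates S A" using minimal_poly(3)[OF A, of S] S0 by blast
  have z: "en (minimal_poly A) i j = 0" if "i < n" "j < n" for i j
    using minimal_poly(2)[OF A] that A by (simp add: annihilates_def)
  have col: "(\<Sum>l<n. A $$ (i, l) * en S l j) = r * en S i j" if ij: "i < n" "j < n" for i j
  proof -
    have "0 = (\<Sum>l<n. en [:- r, 1:] i l * en S l j)"
      using z[OF ij] unfolding mS en_mult[OF ij] by simp
    also have "\<dots> = (\<Sum>l<n. A $$ (i, l) * en S l j - (if i = l then r * en S l j else 0))"
      using ij by (intro sum.cong) (auto simp: en_linear left_diff_distrib)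
    also have "\<dots> = (\<Sum>l<n. A $$ (i, l) * en S l j) - r * en S i j"
      using ij by (simp add: sum_subtractf)
    finally show ?thesis by simp
  qed
  have row: "(\<Sum>l<n. A $$ (l, j) * en S i l) = r * en S i j" if ij: "i < n" "j < n" for i j
  proof -
    have "0 = (\<Sum>l<n. en S i l * en [:- r, 1:] l j)"
      using z[OF ij] unfolding mS mult.commute[of _ S] en_mult[OF ij] by simp
    also have "\<dots> = (\<Sum>l<n. A $$ (l, j) * en S i l - (if l = j then r * en S i l else 0))"
      using ij by (intro sum.cong) (auto simp: en_linear right_diff_distrib)
    also have "\<dots> = (\<Sum>l<n. A $$ (l, j) * en S i l) - r * en S i j"
      using ij by (simp add: sum_subtractf)
    finally show ?thesis by simp
  qed
  have c1: "en S i j = en S i' j" if "i < n" "i' < n" "j < n" for i i' j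
    by (rule regular_eigenvector_constant[OF A nn reach rs, of "\<lambda>l. en S l j"]) (use that col in auto)
  \<comment> \<open>The transpose is again connected, and its row sums are the column sums of
    \<open>A\<close>.\<close>
  have c2: "en S i j = en S i j'" if "i < n" "j < n" "j' < n" for i j j'
  proof (rule regular_eigenvector_constant[of "transpose_mat A" n r "\<lambda>l. en S i l"])
    show "\<exists>k. 0 < (transpose_mat A ^\<^sub>m k) $$ (a, b)" if ab: "a < n" "b < n" for a b
    proof -
      obtain k where "0 < (A ^\<^sub>m k) $$ (b, a)" using reach[OF ab(2,1)] by blast
      then show ?thesis
        using ab carrier_matD[OF pow_carrier_mat[OF A, of k]]
        by (intro exI[of _ k]) (simp add: pow_mat_transpose[OF A])
    qed
  qed (use that A nn cs row in auto)
  define c where "c = en S 0 0"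
  have c: "en S i j = c" if "i < n" "j < n" for i j
    unfolding c_def using c1[of i 0 j] c2[of 0 j 0] that n_pos by simp
  have "c \<noteq> 0"
  proof
    assume "c = 0"
    then have "poly_mat S A = 0\<^sub>m n n" using c A by (intro eq_matI) auto
    then show False using na A by (simp add: annihilates_def)
  qed
  \<comment> \<open>Applying \<open>poly_mat S A\<close> to the all-ones eigenvector reads off the
    value of \<open>S\<close> at \<open>r\<close>.\<close>
  have "poly S r = (poly_mat S A *\<^sub>v (vec n (\<lambda>_. 1))) $ 0"
    using poly_mat_eigenvector[OF A evA, of S] n_pos by simp
  also have "\<dots> = (\<Sum>l<n. en S 0 l)" using A n_pos
    by (simp add: scalar_prod_def atLeast0LessThan)
  also have "\<dots> = real n * c" using c n_pos by simp
  finally have pS: "poly S r = real n * c" .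
  have "hoffman_poly A = Polynomial.smult (real n / poly S r) S"
    using A by (simp add: hoffman_poly_def Let_def perron S_def)
  then have "en (hoffman_poly A) i j = real n / (real n * c) * c"
    using poly_mat_index_smult[OF A ij] c[OF ij] pS by simp
  then show ?thesis using \<open>c \<noteq> 0\<close> n_pos by simp
qed

end

section \<open>Matrices with a distance function\<close>

text \<open>Pythagoras for \<open>Q\<close> and its projection onto the line through
  \<open>W\<close>; the right side is the defect in Cauchy--Schwarz, divided by
  \<open>a\<close>.\<close>

lemma sum_square_diff_projection:
  fixes W Q :: "'i \<Rightarrow> real"
  assumes "a = (\<Sum>x\<in>I. (W x)\<^sup>2)" "b = (\<Sum>x\<in>I. W x * Q x)" "c = (\<Sum>x\<in>I. (Q x)\<^sup>2)" "a \<noteq> 0"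
  shows "(\<Sum>x\<in>I. (Q x - b / a * W x)\<^sup>2) = c - b\<^sup>2 / a"
proof -
  have "(\<Sum>x\<in>I. (Q x - b / a * W x)\<^sup>2)
      = (\<Sum>x\<in>I. (Q x)\<^sup>2 - 2 * (b / a) * (W x * Q x) + (b / a)\<^sup>2 * (W x)\<^sup>2)"
    by (intro sum.cong) (simp_all add: power2_eq_square algebra_simps)
  also have "\<dots> = c - 2 * (b / a) * b + (b / a)\<^sup>2 * a"
    unfolding assms(1-3) by (simp add: sum.distrib sum_subtractf sum_distrib_left)
  also have "\<dots> = c - b\<^sup>2 / a" using assms(4) by (simp add: field_simps power2_eq_square)
  finally show ?thesis .
qed

text \<open>The interface to the digraph: \<open>dst\<close> stands for the directed distance
  between indices, and walk counting enters only through \<open>pow_zero\<close> and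
  \<open>pow_pos\<close>.\<close>

locale dist_mat = real_mat +
  fixes dst :: "nat \<Rightarrow> nat \<Rightarrow> nat"
  assumes entry: "\<And>i j. i < n \<Longrightarrow> j < n \<Longrightarrow> A $$ (i, j) = (if dst i j = 1 then 1 else 0)"
    and dst_0: "\<And>i j. i < n \<Longrightarrow> j < n \<Longrightarrow> dst i j = 0 \<longleftrightarrow> i = j"
    and dst_tri: "\<And>i j k. i < n \<Longrightarrow> j < n \<Longrightarrow> k < n \<Longrightarrow> dst i k \<le> dst i j + dst j k"
    and pow_zero: "\<And>i j k. i < n \<Longrightarrow> j < n \<Longrightarrow> k < dst i j \<Longrightarrow> (A ^\<^sub>m k) $$ (i, j) = 0"
    and pow_pos: "\<And>i j. i < n \<Longrightarrow> j < n \<Longrightarrow> 0 < (A ^\<^sub>m dst i j) $$ (i, j)"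
begin

abbreviation "H \<equiv> hoffman_poly A"
abbreviation "W i j \<equiv> if dst i j = d then en H i j else 0"

definition "wdelta = (\<Sum>i<n. \<Sum>j<n. (W i j)\<^sup>2) / real n"
text \<open>Entries of the \<open>d\<close>-th power replace numbers of paths: at distance
  \<open>d\<close>, walks of length \<open>d\<close> are shortest and hence paths.\<close>

definition "wdelta' = (\<Sum>i<n. \<Sum>j<n. W i j * (A ^\<^sub>m d) $$ (i, j)) / real n"

definition dreg :: bool where
  "dreg \<longleftrightarrow> (\<exists>s :: nat \<Rightarrow> nat \<Rightarrow> nat. \<forall>u<n. \<forall>v<n. \<forall>i\<le>dst u v + 1. 1 \<le> dst u v \<longrightarrow>
    card {w. w < n \<and> dst u w = i \<and> dst v w = 1} = s i (dst u v))"

section \<open>Vanishing entries and the inequality\<close>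

lemma en_lead:
  assumes "i < n" "j < n" "degree f \<le> dst i j"
  shows "en f i j = coeff f (dst i j) * (A ^\<^sub>m dst i j) $$ (i, j)"
proof -
  have "en f i j = (\<Sum>k\<le>dst i j. coeff f k * (A ^\<^sub>m k) $$ (i, j))"
    by (rule poly_mat_index_le[OF A assms])
  \<comment> \<open>Powers below the distance vanish, so only the top term is seen.\<close>
  also have "\<dots> = (\<Sum>k\<le>dst i j. if k = dst i j then coeff f k * (A ^\<^sub>m k) $$ (i, j) else 0)"
    using assms by (intro sum.cong) (auto simp: pow_zero)
  finally show ?thesis by simp
qed

lemma en_zero: "i < n \<Longrightarrow> j < n \<Longrightarrow> degree f < dst i j \<Longrightarrow> en f i j = 0"
  using en_lead[of i j f] by (simp add: coeff_eq_0)

text \<open>\<open>P d\<close> is monic of degree \<open>d\<close>, so at distance \<open>d\<close>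
  its matrix has the same entries as the \<open>d\<close>-th power.\<close>

lemma wdelta'_eq: "wdelta' = (\<Sum>i<n. \<Sum>j<n. W i j * en (P d) i j) / real n"
  unfolding wdelta'_def
  by (intro arg_cong[of _ _ "\<lambda>x. x / real n"] sum.cong refl)
    (auto simp: en_lead coeff_predistance)

text \<open>The projection identity for \<open>poly_mat (P d) A\<close> and \<open>W\<close>, with
  double sums flattened to sums over index pairs; the factor \<open>1 / n\<close> cancels in the
  projection coefficient.\<close>

lemma excess_projection:
  assumes "wdelta \<noteq> 0"
  shows "(\<Sum>i<n. \<Sum>j<n. (en (P d) i j - wdelta' / wdelta * W i j)\<^sup>2) / real n
    = spectral_excess A d - wdelta'\<^sup>2 / wdelta"
proof -
  let ?I = "{..<n} \<times> {..<n}"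
  let ?W = "\<lambda>x. W (fst x) (snd x)" and ?Q = "\<lambda>x. en (P d) (fst x) (snd x)"
  define a where "a = (\<Sum>x\<in>?I. (?W x)\<^sup>2)"
  define b where "b = (\<Sum>x\<in>?I. ?W x * ?Q x)"
  define c where "c = (\<Sum>x\<in>?I. (?Q x)\<^sup>2)"
  have conv: "(\<Sum>i<n. \<Sum>j<n. f i j) = (\<Sum>x\<in>?I. f (fst x) (snd x))" for f :: "nat \<Rightarrow> nat \<Rightarrow> real"
    by (simp add: sum.cartesian_product case_prod_beta)
  have n0: "real n \<noteq> 0" using n_pos by simp
  have a: "wdelta = a / real n" unfolding wdelta_def a_def by (simp only: conv)
  have b: "wdelta' = b / real n" unfolding wdelta'_eq b_def by (simp only: conv)
  have c: "spectral_excess A d = c / real n"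
    unfolding spectral_excess_def poly_inner_eq[OF A] c_def by (simp only: conv power2_eq_square)
  have ba: "wdelta' / wdelta = b / a" using n0 by (simp add: a b)
  have "a \<noteq> 0" using assms a by auto
  have "(\<Sum>i<n. \<Sum>j<n. (en (P d) i j - wdelta' / wdelta * W i j)\<^sup>2) = c - b\<^sup>2 / a"
    unfolding ba conv by (rule sum_square_diff_projection[OF a_def b_def c_def \<open>a \<noteq> 0\<close>])
  then show ?thesis using n0 \<open>a \<noteq> 0\<close>
    by (simp add: a b c field_simps power2_eq_square)
qed

lemma excess_le: "wdelta'\<^sup>2 / wdelta \<le> spectral_excess A d"
proof (cases "wdelta = 0")
  \<comment> \<open>The left side is a division by zero, hence 0.\<close>
  case True
  then show ?thesis using ip_nonneg[of "P d"] by (simp add: spectral_excess_def)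
next
  case False
  have "0 \<le> (\<Sum>i<n. \<Sum>j<n. (en (P d) i j - wdelta' / wdelta * W i j)\<^sup>2) / real n"
    by (intro divide_nonneg_nonneg sum_nonneg) auto
  then show ?thesis using excess_projection[OF False] by simp
qed

text \<open>Equality makes the distance to the projection vanish, so \<open>poly_mat (P d) A\<close>
  is a multiple of \<open>W\<close>.\<close>

lemma excess_eq_imp_support:
  assumes "wdelta'\<^sup>2 / wdelta = spectral_excess A d" "i < n" "j < n" "dst i j \<noteq> d"
  shows "en (P d) i j = 0"
proof -
  have "0 < spectral_excess A d" using predistance_norm_pos[of d] by (simp add: spectral_excess_def)
  \<comment> \<open>Otherwise the quotient would be 0 by convention, against the positive spectral
    excess.\<close>
  then have w: "wdelta \<noteq> 0" using assms(1) by auto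
  have "(\<Sum>i<n. \<Sum>j<n. (en (P d) i j - wdelta' / wdelta * W i j)\<^sup>2) = 0"
    using excess_projection[OF w] assms(1) n_pos by simp
  then have "\<forall>i<n. (\<Sum>j<n. (en (P d) i j - wdelta' / wdelta * W i j)\<^sup>2) = 0"
    by (subst (asm) sum_nonneg_eq_0_iff) (auto intro: sum_nonneg)
  then have "(\<Sum>j<n. (en (P d) i j - wdelta' / wdelta * W i j)\<^sup>2) = 0" using assms(2) by blast
  then have "\<forall>j<n. (en (P d) i j - wdelta' / wdelta * W i j)\<^sup>2 = 0"
    by (subst (asm) sum_nonneg_eq_0_iff) auto
  then have "(en (P d) i j - wdelta' / wdelta * W i j)\<^sup>2 = 0" using assms(3) by blast
  then show ?thesis using assms(4) by simp
qed

lemma reach: "i < n \<Longrightarrow> j < n \<Longrightarrow> \<exists>k. 0 < (A ^\<^sub>m k) $$ (i, j)"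
  using pow_pos by blast

lemma hoffman_entry_1:
  assumes "\<And>i. i < n \<Longrightarrow> (\<Sum>j<n. A $$ (i, j)) = r" "\<And>j. j < n \<Longrightarrow> (\<Sum>i<n. A $$ (i, j)) = r"
    and "i < n" "j < n"
  shows "en H i j = 1"
  by (rule hoffman_regular[OF _ reach assms]) (auto simp: entry)

end

section \<open>From equality to distance-regularity in the normal case\<close>

locale normal_dist_mat = dist_mat + normal_real_mat
begin

definition X :: "real poly" where "X = [:0, 1:]"

lemma en_X: "i < n \<Longrightarrow> j < n \<Longrightarrow> en X i j = A $$ (i, j)"
  unfolding X_def using en_linear[of i j 0] by simp

lemma coeff_X_mult: "coeff (X * f) (Suc k) = coeff f k"
  by (simp add: X_def)

lemma degree_X_mult: "f \<noteq> 0 \<Longrightarrow> degree (X * f) = Suc (degree f)"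
  by (simp add: X_def)

lemma transpose_poly: "\<exists>q. \<forall>i<n. \<forall>j<n. en q i j = A $$ (j, i)"
proof -
  obtain q where q: "transpose_mat A = poly_mat q A" using normal_mat_transpose_eq_poly[OF A normal] by blast
  have "en q i j = A $$ (j, i)" if "i < n" "j < n" for i j
    unfolding q[symmetric] using that A by simp
  then show ?thesis by blast
qed

text \<open>In the entrywise inner product, left multiplication by the transpose is adjoint to left
  multiplication by \<open>A\<close>.\<close>

lemma ip_transpose:
  assumes q: "\<And>i j. i < n \<Longrightarrow> j < n \<Longrightarrow> en q i j = A $$ (j, i)"
  shows "ip (q * f) g = ip f (X * g)"
proof -
  have "(\<Sum>i<n. \<Sum>j<n. en (q * f) i j * en g i j)
      = (\<Sum>i<n. \<Sum>j<n. \<Sum>l<n. A $$ (l, i) * en f l j * en g i j)"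
    by (intro sum.cong refl) (simp add: en_mult q sum_distrib_right)
  also have "\<dots> = (\<Sum>i<n. \<Sum>l<n. \<Sum>j<n. A $$ (l, i) * en f l j * en g i j)"
    by (intro sum.cong refl sum.swap)
  also have "\<dots> = (\<Sum>l<n. \<Sum>i<n. \<Sum>j<n. A $$ (l, i) * en f l j * en g i j)"
    by (rule sum.swap)
  also have "\<dots> = (\<Sum>l<n. \<Sum>j<n. \<Sum>i<n. A $$ (l, i) * en f l j * en g i j)"
    by (intro sum.cong refl sum.swap)
  also have "\<dots> = (\<Sum>l<n. \<Sum>j<n. en f l j * en (X * g) l j)"
    by (intro sum.cong refl) (simp add: en_mult en_X sum_distrib_left mult_ac)
  finally show ?thesis by (simp add: poly_inner_eq[OF A])
qed

text \<open>Otherwise the power of \<open>A\<close> with exponent \<open>dst i j\<close> would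
  reduce to degree at most \<open>d\<close> and vanish at \<open>(i, j)\<close>, where it is
  positive.\<close>

lemma dst_le:
  assumes "i < n" "j < n" shows "dst i j \<le> d"
proof (rule ccontr)
  assume "\<not> dst i j \<le> d"
  obtain g where g: "degree g \<le> d" "poly_mat g A = poly_mat (monom 1 (dst i j)) A"
    using poly_mat_reduce by blast
  have "en g i j = 0" using \<open>\<not> dst i j \<le> d\<close> g(1) assms by (intro en_zero) auto
  then show False using g(2) pow_pos[OF assms] by (simp add: poly_mat_monom[OF A])
qed

text \<open>With \<open>A\<^sup>T = q(A)\<close>, the expansion of \<open>A\<^sup>T P\<^sub>k(A)\<close> starts at \<open>P\<^sub>k\<^sub>-\<^sub>1\<close> with a positive
  coefficient, and \<open>A\<^sup>T P\<^sub>k(A)\<close> vanishes at distances below \<open>k - 1\<close>.\<close>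

lemma support_step:
  assumes k: "Suc k \<le> d"
    and supp: "\<And>m i j. k < m \<Longrightarrow> m \<le> d \<Longrightarrow> i < n \<Longrightarrow> j < n \<Longrightarrow> dst i j \<noteq> m \<Longrightarrow> en (P m) i j = 0"
    and ij: "i < n" "j < n" and ne: "dst i j \<noteq> k"
  shows "en (P k) i j = 0"
proof (cases "k < dst i j")
  case True
  then show ?thesis using ij by (intro en_zero) auto
next
  case False
  then have lt: "dst i j < k" using ne by simp
  obtain q where q: "\<And>i j. i < n \<Longrightarrow> j < n \<Longrightarrow> en q i j = A $$ (j, i)" using transpose_poly by blast
  obtain g where g: "degree g \<le> d" "poly_mat g A = poly_mat (q * P (Suc k)) A"
    using poly_mat_reduce by blast
  have ipg: "ip g h = ip (P (Suc k)) (X * h)" for h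
    using ip_transpose[OF q, of "P (Suc k)" h] by (simp add: poly_inner_eq[OF A] g(2))
  let ?a = "\<lambda>m. ip g (P m) / ip (P m) (P m)"
  have low: "?a m = 0" if "m < k" for m
  proof -
    have "degree (X * P m) = Suc m" by (simp add: degree_X_mult)
    then have "ip g (P m) = 0" unfolding ipg using that k by (intro predistance_orth_poly) auto
    then show ?thesis by simp
  qed
  have "?a k \<noteq> 0"
  proof -
    \<comment> \<open>Both polynomials are monic of degree \<open>Suc k\<close>, so
      \<open>?r\<close> is orthogonal to \<open>P (Suc k)\<close> and the inner product of
      \<open>X * P k\<close> with \<open>P (Suc k)\<close> is the squared norm of the
      latter.\<close>
    let ?r = "X * P k - P (Suc k)"
    have "\<forall>m\<ge>Suc k. coeff ?r m = 0"
    proof (intro allI impI)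
      fix m assume "m \<ge> Suc k"
      then obtain l where l: "m = Suc l" "l \<ge> k" by (cases m) auto
      show "coeff ?r m = 0"
        using l coeff_predistance[of k] coeff_predistance[of "Suc k"]
        by (cases "l = k") (auto simp: coeff_X_mult)
    qed
    then obtain c where c: "?r = (\<Sum>i<Suc k. Polynomial.smult (c i) (P i))"
      using predistance_span[of "Suc k" ?r] by blast
    have "ip ?r (P (Suc k)) = 0"
      unfolding c ip_sum ip_smult using k by (intro sum.neutral) (auto simp: predistance_orth)
    then have "ip (X * P k) (P (Suc k)) = ip (P (Suc k)) (P (Suc k))" by (simp only: ip_diff)
    then have "ip g (P k) > 0"
      unfolding ipg using predistance_norm_pos[OF k] by (simp only: ip_commute)
    then show ?thesis using predistance_norm_pos[of k] k by simp
  qed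
  have "en g i j = (\<Sum>m\<le>d. ?a m * en (P m) i j)"
    by (subst predistance_expansion[OF g(1)])
      (simp add: poly_mat_index_sum[OF A ij] poly_mat_index_smult[OF A ij])
  \<comment> \<open>Terms with \<open>m < k\<close> have coefficient zero; those with
    \<open>m > k\<close> vanish by \<open>supp\<close>, the distance being below
    \<open>k\<close>.\<close>
  also have "\<dots> = (\<Sum>m\<le>d. if m = k then ?a k * en (P k) i j else 0)"
  proof (intro sum.cong refl)
    fix m assume "m \<in> {..d}"
    then show "?a m * en (P m) i j = (if m = k then ?a k * en (P k) i j else 0)"
      using low[of m] supp[of m i j] ij lt by (cases m k rule: linorder_cases) auto
  qed
  also have "\<dots> = ?a k * en (P k) i j" using k by simp
  finally have e: "en g i j = ?a k * en (P k) i j" .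
  have "en g i j = (\<Sum>l<n. A $$ (l, i) * en (P (Suc k)) l j)"
    unfolding g(2) using ij by (simp add: en_mult q)
  also have "\<dots> = 0"
  proof (intro sum.neutral ballI)
    fix l assume "l \<in> {..<n}"
    then have l: "l < n" by simp
    show "A $$ (l, i) * en (P (Suc k)) l j = 0"
    proof (cases "dst l i = 1")
      case True
      \<comment> \<open>One more arc in front gives distance at most \<open>Suc (dst i j)\<close>,
        which is still below \<open>Suc k\<close>.\<close>
      then have "dst l j \<noteq> Suc k" using dst_tri[OF l ij] lt by simp
      then show ?thesis using supp[of "Suc k" l j] l ij k by simp
    qed (use l ij in \<open>simp add: entry\<close>)
  qed
  finally show ?thesis using e \<open>?a k \<noteq> 0\<close> by simp
qed

text \<open>Downward induction from \<open>k = d\<close>, run on \<open>d - k\<close>.\<close>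

lemma support_all:
  assumes supp: "\<And>i j. i < n \<Longrightarrow> j < n \<Longrightarrow> dst i j \<noteq> d \<Longrightarrow> en (P d) i j = 0"
    and "k \<le> d" "i < n" "j < n" "dst i j \<noteq> k"
  shows "en (P k) i j = 0"
  using assms(2-)
proof (induction "d - k" arbitrary: k i j rule: less_induct)
  case less
  show ?case
  proof (cases "k = d")
    case True
    then show ?thesis using supp less.prems by simp
  next
    case False
    then have "Suc k \<le> d" using less.prems by simp
    then show ?thesis by (rule support_step) (use less in auto)
  qed
qed

lemma support_imp_dreg:
  assumes supp: "\<And>i j. i < n \<Longrightarrow> j < n \<Longrightarrow> dst i j \<noteq> d \<Longrightarrow> en (P d) i j = 0"
  shows dreg
proof -
  have suppk: "en (P k) i j = 0" if "k \<le> d" "i < n" "j < n" "dst i j \<noteq> k" for k i j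
    by (rule support_all[OF _ that]) (rule supp)
  obtain q where q: "\<And>i j. i < n \<Longrightarrow> j < n \<Longrightarrow> en q i j = A $$ (j, i)" using transpose_poly by blast
  \<comment> \<open>In the expansion of the reduced polynomial, only the term with index
    \<open>dst i j\<close> is nonzero at \<open>(i, j)\<close>.\<close>
  have ex_a: "\<exists>a. \<forall>i<n. \<forall>j<n. en f i j = a (dst i j) * en (P (dst i j)) i j" for f
  proof -
    obtain g where g: "degree g \<le> d" "poly_mat g A = poly_mat f A"
      using poly_mat_reduce by blast
    let ?a = "\<lambda>m. ip g (P m) / ip (P m) (P m)"
    have "en f i j = ?a (dst i j) * en (P (dst i j)) i j" if ij: "i < n" "j < n" for i j
    proof -
      have "en g i j = (\<Sum>m\<le>d. ?a m * en (P m) i j)"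
        by (subst predistance_expansion[OF g(1)])
          (simp add: poly_mat_index_sum[OF A ij] poly_mat_index_smult[OF A ij])
      also have "\<dots> = (\<Sum>m\<le>d. if m = dst i j then ?a (dst i j) * en (P (dst i j)) i j else 0)"
        using ij suppk by (intro sum.cong refl) auto
      also have "\<dots> = ?a (dst i j) * en (P (dst i j)) i j" using dst_le[OF ij] by simp
      finally show ?thesis using g(2) by simp
    qed
    then show ?thesis by (intro exI[of _ ?a] allI impI)
  qed
  define a where "a f = (SOME a. \<forall>i<n. \<forall>j<n. en f i j = a (dst i j) * en (P (dst i j)) i j)" for f
  have a: "en f i j = a f (dst i j) * en (P (dst i j)) i j" if "i < n" "j < n" for f i j
    using someI_ex[OF ex_a[of f]] that unfolding a_def[symmetric] by simp
  \<comment> \<open>\<open>P 0 = 1\<close>, so polynomials in \<open>A\<close> have constant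
    diagonal. As entries are 0 or 1, the diagonal of \<open>q * X\<close> gives the column sums and
    that of the equal polynomial \<open>X * q\<close> the row sums.\<close>
  define r where "r = a (q * X) 0"
  have P0: "P 0 = 1" by (subst predistance_poly.simps) simp
  have diag: "en (q * X) i i = r" if "i < n" for i
  proof -
    have "dst i i = 0" using dst_0[OF that that] by blast
    moreover have "en (P 0) i i = 1" unfolding P0 poly_mat_1[OF A] using that by simp
    ultimately show ?thesis unfolding r_def a[OF that that, of "q * X"] by (simp only: mult_1_right)
  qed
  have cs: "(\<Sum>l<n. A $$ (l, i)) = r" if "i < n" for i
  proof -
    have "r = (\<Sum>l<n. A $$ (l, i) * A $$ (l, i))"
      unfolding diag[OF that, symmetric] using that by (simp add: en_mult en_X q)
    also have "\<dots> = (\<Sum>l<n. A $$ (l, i))" using that by (intro sum.cong) (auto simp: entry)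
    finally show ?thesis by simp
  qed
  have rs: "(\<Sum>l<n. A $$ (i, l)) = r" if "i < n" for i
  proof -
    have "r = en (X * q) i i" unfolding diag[OF that, symmetric] by (simp only: mult.commute)
    also have "\<dots> = (\<Sum>l<n. A $$ (i, l) * A $$ (i, l))"
      using that by (simp add: en_mult en_X q)
    also have "\<dots> = (\<Sum>l<n. A $$ (i, l))" using that by (intro sum.cong) (auto simp: entry)
    finally show ?thesis by simp
  qed
  define h where "h = a H"
  \<comment> \<open>The Hoffman matrix is all ones, so \<open>P k\<close> has the constant nonzero
    entry \<open>1 / h k\<close> at every pair at distance \<open>k\<close>.\<close>
  have h: "h (dst i j) * en (P (dst i j)) i j = 1" if "i < n" "j < n" for i j
    using hoffman_entry_1[OF rs cs that] a[OF that, of H] by (simp add: h_def)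
  have const: "en f i j = a f (dst i j) / h (dst i j)" if "i < n" "j < n" for f i j
  proof -
    have "h (dst i j) \<noteq> 0" using h[OF that] by auto
    then show ?thesis using h[OF that] a[OF that, of f] by (simp add: field_simps)
  qed
  have ex_b: "\<exists>b. \<forall>u<n. \<forall>v<n. real (card {w. w < n \<and> dst u w = i \<and> dst v w = 1}) = b (dst u v)" for i
  proof (cases "i \<le> d")
    case True
    \<comment> \<open>\<open>f\<close> represents the distance-\<open>i\<close> matrix, and the
      entries of its product with the transpose of \<open>A\<close> are the intersection
      numbers.\<close>
    define f where "f = Polynomial.smult (h i) (P i)"
    have f: "en f u w = (if dst u w = i then 1 else 0)" if "u < n" "w < n" for u w
      unfolding f_def poly_mat_index_smult[OF A that] using h[OF that] suppk[OF True that] by (cases "dst u w = i") auto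
    have "real (card {w. w < n \<and> dst u w = i \<and> dst v w = 1}) = en (f * q) u v"
      if uv: "u < n" "v < n" for u v
    proof -
      have "en (f * q) u v = (\<Sum>w<n. if dst u w = i \<and> dst v w = 1 then 1 else 0)"
        unfolding en_mult[OF uv] using uv by (intro sum.cong) (auto simp: f q entry)
      also have "\<dots> = real (card ({..<n} \<inter> {w. dst u w = i \<and> dst v w = 1}))"
        by (simp add: sum.If_cases)
      also have "{..<n} \<inter> {w. dst u w = i \<and> dst v w = 1} = {w. w < n \<and> dst u w = i \<and> dst v w = 1}"
        by auto
      finally show ?thesis by simp
    qed
    then show ?thesis using const[of _ _ "f * q"]
      by (intro exI[of _ "\<lambda>k. a (f * q) k / h k"]) auto
  next
    case False
    then have "{w. w < n \<and> dst u w = i \<and> dst v w = 1} = {}" if "u < n" for u v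
      using dst_le[OF that] by auto
    then show ?thesis by (intro exI[of _ "\<lambda>_. 0"]) auto
  qed
  define b where "b i = (SOME b. \<forall>u<n. \<forall>v<n.
    real (card {w. w < n \<and> dst u w = i \<and> dst v w = 1}) = b (dst u v))" for i
  have b: "real (card {w. w < n \<and> dst u w = i \<and> dst v w = 1}) = b i (dst u v)"
    if "u < n" "v < n" for i u v
    using someI_ex[OF ex_b[of i]] that unfolding b_def[symmetric] by simp
  \<comment> \<open>\<open>b\<close> is real-valued; rounding down recovers the natural
    number.\<close>
  have "card {w. w < n \<and> dst u w = i \<and> dst v w = 1} = nat \<lfloor>b i (dst u v)\<rfloor>"
    if "u < n" "v < n" for i u v
    unfolding b[OF that, symmetric] by simp
  then show ?thesis unfolding dreg_def by (intro exI[of _ "\<lambda>i k. nat \<lfloor>b i k\<rfloor>"]) blast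
qed

end

text \<open>Turns \<open>transpose_mat A = poly_mat q A\<close> into an expression of
  \<open>A\<close> as a polynomial in its transpose.\<close>

lemma poly_mat_transpose:
  fixes A :: "real mat"
  assumes A: "A \<in> carrier_mat n n"
  shows "transpose_mat (poly_mat q A) = poly_mat q (transpose_mat A)"
proof (rule eq_matI)
  fix i j assume "i < dim_row (poly_mat q (transpose_mat A))" "j < dim_col (poly_mat q (transpose_mat A))"
  then have ij: "i < n" "j < n" using A by auto
  have "transpose_mat (poly_mat q A) $$ (i, j) = (\<Sum>k\<le>degree q. coeff q k * (A ^\<^sub>m k) $$ (j, i))"
    using ij A poly_mat_index_le[OF A ij(2,1), of q "degree q"] by simp
  also have "\<dots> = (\<Sum>k\<le>degree q. coeff q k * (transpose_mat A ^\<^sub>m k) $$ (i, j))"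
    using ij A by (intro sum.cong refl) (simp add: pow_mat_transpose[OF A])
  also have "\<dots> = poly_mat q (transpose_mat A) $$ (i, j)"
    using poly_mat_index_le[of "transpose_mat A" n i j q "degree q"] A ij by simp
  finally show "transpose_mat (poly_mat q A) $$ (i, j) = poly_mat q (transpose_mat A) $$ (i, j)" .
qed (use A in auto)

section \<open>From distance-regularity to equality in the normal case\<close>

context normal_dist_mat
begin

text \<open>The linear span of the distance matrices, described entrywise.\<close>

definition dist_const :: "real mat \<Rightarrow> bool" where
  "dist_const M \<longleftrightarrow> M \<in> carrier_mat n n \<and> (\<exists>b. \<forall>u<n. \<forall>v<n. M $$ (u, v) = b (dst u v))"

lemma dist_constI:
  assumes "M \<in> carrier_mat n n" "\<And>u v. u < n \<Longrightarrow> v < n \<Longrightarrow> M $$ (u, v) = b (dst u v)"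
  shows "dist_const M"
  unfolding dist_const_def using assms by (intro conjI exI[of _ b] allI impI) auto

lemma dist_constE:
  assumes "dist_const M"
  obtains b where "M \<in> carrier_mat n n" "\<forall>u<n. \<forall>v<n. M $$ (u, v) = b (dst u v)"
  using assms unfolding dist_const_def by (elim conjE exE)

lemma dist_const_add:
  assumes "dist_const M" "dist_const N" shows "dist_const (M + N)"
proof -
  from assms(1) obtain b where b: "M \<in> carrier_mat n n" "\<forall>u<n. \<forall>v<n. M $$ (u, v) = b (dst u v)"
    by (rule dist_constE)
  from assms(2) obtain c where c: "N \<in> carrier_mat n n" "\<forall>u<n. \<forall>v<n. N $$ (u, v) = c (dst u v)"
    by (rule dist_constE)
  show ?thesis by (rule dist_constI[of _ "\<lambda>k. b k + c k"]) (use b c in auto)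
qed

lemma dist_const_smult:
  assumes "dist_const M" shows "dist_const (a \<cdot>\<^sub>m M)"
proof -
  from assms obtain b where b: "M \<in> carrier_mat n n" "\<forall>u<n. \<forall>v<n. M $$ (u, v) = b (dst u v)"
    by (rule dist_constE)
  show ?thesis by (rule dist_constI[of _ "\<lambda>k. a * b k"]) (use b in auto)
qed

lemma dist_const_one: "dist_const (1\<^sub>m n)"
  by (rule dist_constI[of _ "\<lambda>k. if k = 0 then 1 else 0"]) (auto simp: dst_0)

text \<open>Used twice: with \<open>B\<close> the transpose of \<open>A\<close>, which makes right
  multiplication by \<open>A\<close> admissible, and then with \<open>B = A\<close>.\<close>

lemma dist_const_mult_poly:
  assumes B: "B \<in> carrier_mat n n" and step: "\<And>M. dist_const M \<Longrightarrow> dist_const (M * B)"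
    and M: "dist_const M"
  shows "dist_const (M * poly_mat f B)"
  using M
proof (induction f arbitrary: M)
  case 0
  have "M \<in> carrier_mat n n" using 0 by (simp add: dist_const_def)
  then have "M * poly_mat 0 B = 0 \<cdot>\<^sub>m M" using B right_mult_zero_mat[of M n n n] by (intro eq_matI) auto
  then show ?case using dist_const_smult[OF 0, of 0] by simp
next
  case (pCons a f)
  have Mc: "M \<in> carrier_mat n n" using pCons.prems by (simp add: dist_const_def)
  have "M * poly_mat (pCons a f) B = M * (a \<cdot>\<^sub>m 1\<^sub>m n) + M * (B * poly_mat f B)"
    unfolding poly_mat_pCons[OF B] by (rule mult_add_distrib_mat[of _ n n _ n]) (use B Mc in auto)
  also have "M * (a \<cdot>\<^sub>m 1\<^sub>m n) = a \<cdot>\<^sub>m M"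
    using Mc by (simp add: mult_smult_distrib[OF Mc one_carrier_mat])
  also have "M * (B * poly_mat f B) = (M * B) * poly_mat f B"
    by (rule assoc_mult_mat[of _ n n _ n _ n, symmetric]) (use B Mc in auto)
  finally show ?case
    using dist_const_add[OF dist_const_smult[OF pCons.prems] pCons.IH[OF step[OF pCons.prems]]] by simp
qed

lemma row_sum_card: "v < n \<Longrightarrow> (\<Sum>w<n. A $$ (v, w)) = real (card {w. w < n \<and> dst v w = 1})"
proof -
  assume v: "v < n"
  have "(\<Sum>w<n. A $$ (v, w)) = (\<Sum>w<n. if dst v w = 1 then 1 else 0)"
    using v by (intro sum.cong) (auto simp: entry)
  also have "\<dots> = real (card ({..<n} \<inter> {w. dst v w = 1}))" by (simp add: sum.If_cases)
  also have "{..<n} \<inter> {w. dst v w = 1} = {w. w < n \<and> dst v w = 1}" by auto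
  finally show ?thesis .
qed

text \<open>For a 0-1 matrix, the diagonals of the two products in \<open>normal_mat\<close> hold
  the column sums and the row sums.\<close>

lemma normal_row_col_sum:
  assumes i: "i < n" shows "(\<Sum>l<n. A $$ (l, i)) = (\<Sum>l<n. A $$ (i, l))"
proof -
  have "(\<Sum>l<n. A $$ (l, i)) = (\<Sum>l<n. transpose_mat A $$ (i, l) * A $$ (l, i))"
    using i A by (intro sum.cong) (auto simp: entry)
  also have "\<dots> = (transpose_mat A * A) $$ (i, i)"
    by (rule index_mult_sum[symmetric]) (use A i in auto)
  also have "\<dots> = (A * transpose_mat A) $$ (i, i)" using normal by (simp add: normal_mat_def)
  also have "\<dots> = (\<Sum>l<n. A $$ (i, l) * transpose_mat A $$ (l, i))"
    by (rule index_mult_sum) (use A i in auto)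
  also have "\<dots> = (\<Sum>l<n. A $$ (i, l))"
    using i A by (intro sum.cong) (auto simp: entry)
  finally show ?thesis .
qed

text \<open>The last arc of a shortest walk from \<open>u\<close> to \<open>v\<close> provides
  \<open>l\<close>.\<close>

lemma in_neighbour:
  assumes u: "u < n" and v: "v < n" and "u \<noteq> v" shows "\<exists>l<n. dst l v = 1"
proof -
  obtain k where k: "dst u v = Suc k" using dst_0[OF u v] assms(3) by (cases "dst u v") auto
  have "0 < (A ^\<^sub>m Suc k) $$ (u, v)" using pow_pos[OF u v] k by simp
  also have "(A ^\<^sub>m Suc k) $$ (u, v) = (\<Sum>l<n. (A ^\<^sub>m k) $$ (u, l) * A $$ (l, v))"
    using index_mult_sum[OF pow_carrier_mat[OF A] A u v, of k] by simp
  finally have pos: "0 < (\<Sum>l<n. (A ^\<^sub>m k) $$ (u, l) * A $$ (l, v))" .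
  show ?thesis
  proof (rule ccontr)
    assume "\<not> ?thesis"
    then have "(\<Sum>l<n. (A ^\<^sub>m k) $$ (u, l) * A $$ (l, v)) = 0"
      using v by (intro sum.neutral) (auto simp: entry)
    then show False using pos by simp
  qed
qed

text \<open>Supplies the count at distance 0, which \<open>dreg\<close> leaves open. The
  out-neighbours of \<open>v\<close> are sorted by their distance from an in-neighbour
  \<open>l\<close> of \<open>v\<close>, which is at most 2.\<close>

lemma dreg_regular:
  assumes s: "\<And>u v i. u < n \<Longrightarrow> v < n \<Longrightarrow> i \<le> dst u v + 1 \<Longrightarrow> 1 \<le> dst u v \<Longrightarrow>
    card {w. w < n \<and> dst u w = i \<and> dst v w = 1} = s i (dst u v)"
  shows "\<exists>r. \<forall>v<n. card {w. w < n \<and> dst v w = 1} = r"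
proof (cases "n = 1")
  case True
  then show ?thesis by auto
next
  case False
  have "card {w. w < n \<and> dst v w = 1} = (\<Sum>i\<le>2. s i 1)" if v: "v < n" for v
  proof -
    have "\<exists>u<n. u \<noteq> v" using False n_pos
      by (cases "v = 0") (auto intro: exI[of _ 0] exI[of _ 1])
    then obtain l where l: "l < n" "dst l v = 1" using in_neighbour v by blast
    have "{w. w < n \<and> dst v w = 1} = (\<Union>i\<le>2. {w. w < n \<and> dst l w = i \<and> dst v w = 1})"
      using dst_tri[OF l(1) v] l(2) by force
    also have "card \<dots> = (\<Sum>i\<le>2. card {w. w < n \<and> dst l w = i \<and> dst v w = 1})"
      by (rule card_UN_disjoint) auto
    also have "\<dots> = (\<Sum>i\<le>2. s i 1)"
      using s[OF l(1) v] l(2) by (intro sum.cong) auto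
    finally show ?thesis .
  qed
  then show ?thesis by blast
qed

text \<open>Entry \<open>(u, v)\<close> sums row \<open>u\<close> of \<open>M\<close> over the
  out-neighbours of \<open>v\<close>; grouping these by their distance from \<open>u\<close> leaves
  the numbers \<open>t\<close>.\<close>

lemma dist_const_mult_transpose:
  assumes t: "\<And>u v i. u < n \<Longrightarrow> v < n \<Longrightarrow>
    card {w. w < n \<and> dst u w = i \<and> dst v w = 1} = t i (dst u v)"
    and "dist_const M"
  shows "dist_const (M * transpose_mat A)"
proof -
  from assms(2) obtain b where b: "M \<in> carrier_mat n n" "\<forall>u<n. \<forall>v<n. M $$ (u, v) = b (dst u v)"
    by (rule dist_constE)
  show ?thesis
  proof (rule dist_constI[of _ "\<lambda>k. \<Sum>i\<le>d. b i * real (t i k)"])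
    fix u v assume uv: "u < n" "v < n"
    have "(M * transpose_mat A) $$ (u, v) = (\<Sum>w<n. M $$ (u, w) * transpose_mat A $$ (w, v))"
      by (rule index_mult_sum) (use A b uv in auto)
    also have "\<dots> = (\<Sum>w<n. \<Sum>i\<le>d. if dst u w = i \<and> dst v w = 1 then b i else 0)"
    proof (intro sum.cong refl)
      fix w assume "w \<in> {..<n}"
      then have w: "w < n" by simp
      have "(\<Sum>i\<le>d. if dst u w = i \<and> dst v w = 1 then b i else 0)
          = (\<Sum>i\<le>d. if i = dst u w then (if dst v w = 1 then b i else 0) else 0)"
        by (intro sum.cong) auto
      also have "\<dots> = (if dst v w = 1 then b (dst u w) else 0)" using dst_le[OF uv(1) w] by simp
      finally show "M $$ (u, w) * transpose_mat A $$ (w, v)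
          = (\<Sum>i\<le>d. if dst u w = i \<and> dst v w = 1 then b i else 0)"
        using uv w A b(2) by (simp add: entry)
    qed
    also have "\<dots> = (\<Sum>i\<le>d. \<Sum>w<n. if dst u w = i \<and> dst v w = 1 then b i else 0)"
      by (rule sum.swap)
    also have "\<dots> = (\<Sum>i\<le>d. b i * real (t i (dst u v)))"
    proof (intro sum.cong refl)
      fix i
      have "(\<Sum>w<n. if dst u w = i \<and> dst v w = 1 then b i else 0)
          = b i * real (card ({..<n} \<inter> {w. dst u w = i \<and> dst v w = 1}))"
        by (simp add: sum.If_cases)
      also have "{..<n} \<inter> {w. dst u w = i \<and> dst v w = 1} = {w. w < n \<and> dst u w = i \<and> dst v w = 1}"
        by auto
      finally show "(\<Sum>w<n. if dst u w = i \<and> dst v w = 1 then b i else 0) = b i * real (t i (dst u v))"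
        using t[OF uv] by simp
    qed
    finally show "(M * transpose_mat A) $$ (u, v) = (\<Sum>i\<le>d. b i * real (t i (dst u v)))" .
  qed (use A b in auto)
qed

text \<open>Right multiplication by \<open>A\<close>, as a polynomial in the transpose, preserves
  \<open>dist_const\<close>; start from the identity matrix.\<close>

lemma dist_const_poly:
  assumes t: "\<And>u v i. u < n \<Longrightarrow> v < n \<Longrightarrow>
    card {w. w < n \<and> dst u w = i \<and> dst v w = 1} = t i (dst u v)"
  shows "dist_const (poly_mat f A)"
proof -
  obtain q where q: "transpose_mat A = poly_mat q A" using normal_mat_transpose_eq_poly[OF A normal] by blast
  have At: "A = poly_mat q (transpose_mat A)"
    using poly_mat_transpose[OF A, of q] unfolding q[symmetric] by simp
  have "dist_const (M * poly_mat q (transpose_mat A))" if "dist_const M" for M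
    by (rule dist_const_mult_poly[OF _ dist_const_mult_transpose[OF t] that]) (use A in auto)
  then have "dist_const (M * A)" if "dist_const M" for M
    unfolding At[symmetric] using that by simp
  then have "dist_const (1\<^sub>m n * poly_mat f A)"
    by (rule dist_const_mult_poly[OF A _ dist_const_one])
  then show ?thesis using A by simp
qed

lemma dreg_imp_excess_eq:
  assumes dreg shows "wdelta'\<^sup>2 / wdelta = spectral_excess A d"
proof -
  obtain s where s: "\<And>u v i. u < n \<Longrightarrow> v < n \<Longrightarrow> i \<le> dst u v + 1 \<Longrightarrow> 1 \<le> dst u v \<Longrightarrow>
      card {w. w < n \<and> dst u w = i \<and> dst v w = 1} = s i (dst u v)"
    using assms unfolding dreg_def by blast
  obtain r where r: "\<And>v. v < n \<Longrightarrow> card {w. w < n \<and> dst v w = 1} = r"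
    using dreg_regular[OF s] by blast
  \<comment> \<open>\<open>t\<close> extends \<open>s\<close> to all indices: at distance 0 only the
    out-degree \<open>r\<close> counts, and beyond \<open>k + 1\<close> the triangle inequality
    leaves nothing.\<close>
  define t where "t i k = (if k = 0 then (if i = 1 then r else 0) else if i \<le> k + 1 then s i k else 0)" for i k
  have t: "card {w. w < n \<and> dst u w = i \<and> dst v w = 1} = t i (dst u v)" if uv: "u < n" "v < n" for u v i
  proof (cases "dst u v = 0")
    case True
    then have "u = v" using dst_0[OF uv] by simp
    then show ?thesis using True r[OF uv(1)] by (cases "i = 1") (auto simp: t_def)
  next
    case False
    show ?thesis
    proof (cases "i \<le> dst u v + 1")
      case True
      then show ?thesis using s[OF uv True] False by (simp add: t_def)
    next
      case gt: False
      then have "{w. w < n \<and> dst u w = i \<and> dst v w = 1} = {}" using dst_tri[OF uv] by fastforce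
      then show ?thesis using gt False by (simp add: t_def)
    qed
  qed
  have rs: "(\<Sum>j<n. A $$ (i, j)) = real r" if "i < n" for i using row_sum_card[OF that] r[OF that] by simp
  have cs: "(\<Sum>i<n. A $$ (i, j)) = real r" if "j < n" for j using normal_row_col_sum[OF that] rs[OF that] by simp
  note H1 = hoffman_entry_1[OF rs cs]
  have "dist_const (poly_mat (P d) A)" by (rule dist_const_poly[OF t])
  then obtain b where b': "poly_mat (P d) A \<in> carrier_mat n n" "\<forall>u<n. \<forall>v<n. en (P d) u v = b (dst u v)"
    by (rule dist_constE)
  note b = b'(2)[rule_format]
  \<comment> \<open>Pair \<open>P d\<close> with the power \<open>j = dst u v\<close>. At smaller
    distances \<open>b\<close> vanishes by induction, at larger ones the power does. What remains is
    \<open>b j\<close> times a positive sum.\<close>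
  have b0: "b (dst u v) = 0" if "u < n" "v < n" "dst u v < d" for u v
    using that
  proof (induction "dst u v" arbitrary: u v rule: less_induct)
    case less
    define j where "j = dst u v"
    have "ip (P d) (monom 1 j) = 0"
      using less.prems by (intro predistance_orth_poly) (auto simp: j_def degree_monom_eq)
    then have "0 = (\<Sum>x<n. \<Sum>y<n. en (P d) x y * (A ^\<^sub>m j) $$ (x, y))"
      using n_pos by (simp add: poly_inner_eq[OF A] poly_mat_monom[OF A])
    also have "\<dots> = (\<Sum>x<n. \<Sum>y<n. b j * (if dst x y = j then (A ^\<^sub>m j) $$ (x, y) else 0))"
    proof (intro sum.cong refl)
      fix x y assume "x \<in> {..<n}" "y \<in> {..<n}"
      then have xy: "x < n" "y < n" by auto
      show "en (P d) x y * (A ^\<^sub>m j) $$ (x, y) = b j * (if dst x y = j then (A ^\<^sub>m j) $$ (x, y) else 0)"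
        using b[OF xy] pow_zero[OF xy, of j] less.hyps[OF _ xy] less.prems
        by (cases "dst x y" j rule: linorder_cases) (auto simp: j_def)
    qed
    also have "\<dots> = b j * (\<Sum>x<n. \<Sum>y<n. if dst x y = j then (A ^\<^sub>m j) $$ (x, y) else 0)"
      by (simp add: sum_distrib_left)
    finally have e: "b j * (\<Sum>x<n. \<Sum>y<n. if dst x y = j then (A ^\<^sub>m j) $$ (x, y) else 0) = 0" by simp
    have nn: "0 \<le> (if dst x y = j then (A ^\<^sub>m j) $$ (x, y) else 0)" if "x < n" "y < n" for x y
      using pow_pos[OF that] by auto
    have "0 < (A ^\<^sub>m j) $$ (u, v)" using pow_pos less.prems by (simp add: j_def)
    also have "\<dots> = (if dst u v = j then (A ^\<^sub>m j) $$ (u, v) else 0)" by (simp add: j_def)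
    also have "\<dots> \<le> (\<Sum>y<n. if dst u y = j then (A ^\<^sub>m j) $$ (u, y) else 0)"
      by (rule member_le_sum) (use less.prems nn in auto)
    also have "\<dots> \<le> (\<Sum>x<n. \<Sum>y<n. if dst x y = j then (A ^\<^sub>m j) $$ (x, y) else 0)"
      by (rule member_le_sum[of _ _ "\<lambda>x. \<Sum>y<n. if dst x y = j then (A ^\<^sub>m j) $$ (x, y) else 0"])
        (use less.prems nn in \<open>auto intro!: sum_nonneg\<close>)
    finally show "b (dst u v) = 0" using e by (simp add: j_def)
  qed
  have Pd: "en (P d) u v = (if dst u v = d then b d else 0)" if uv: "u < n" "v < n" for u v
    using b[OF uv] b0[OF uv] dst_le[OF uv] by (cases "dst u v < d") auto
  \<comment> \<open>\<open>N\<close> counts the pairs at distance \<open>d\<close>; all three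
    quantities are multiples of it, and the final identity also holds for \<open>N = 0\<close>,
    where both sides are 0.\<close>
  define N where "N = (\<Sum>u<n. \<Sum>v<n. if dst u v = d then 1 else 0 :: real)"
  have "wdelta = N / real n" unfolding wdelta_def N_def
    by (intro arg_cong[of _ _ "\<lambda>x. x / real n"] sum.cong refl) (auto simp: H1)
  moreover have "wdelta' = b d * N / real n" unfolding wdelta'_eq N_def sum_distrib_left
    by (intro arg_cong[of _ _ "\<lambda>x. x / real n"] sum.cong refl) (auto simp: H1 Pd)
  moreover have "spectral_excess A d = (b d)\<^sup>2 * N / real n"
    unfolding spectral_excess_def poly_inner_eq[OF A] N_def sum_distrib_left
    by (intro arg_cong[of _ _ "\<lambda>x. x / real n"] sum.cong refl) (auto simp: Pd power2_eq_square)
  ultimately show ?thesis using n_pos by (simp add: power2_eq_square)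
qed

theorem excess_eq_iff_dreg: "wdelta'\<^sup>2 / wdelta = spectral_excess A d \<longleftrightarrow> dreg"
  using dreg_imp_excess_eq support_imp_dreg excess_eq_imp_support by blast

end

section \<open>Walks in strongly connected digraphs\<close>

locale indexed_digraph = digraph G for G :: "('a, 'b) pre_digraph" (structure) +
  fixes ix :: "'a \<Rightarrow> nat"
  assumes strong: "strongly_connected G"
    and bij: "bij_betw ix (verts G) {..<card (verts G)}"
begin

abbreviation "N \<equiv> card (verts G)"
abbreviation "M \<equiv> adjacency_mat G ix"

definition idist :: "nat \<Rightarrow> nat \<Rightarrow> nat" where
  "idist i j = ddist G (inv_into (verts G) ix i) (inv_into (verts G) ix j)"

lemma M_carrier: "M \<in> carrier_mat N N"
  by (simp add: adjacency_mat_def)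

lemma N_pos: "0 < N"
  using strong by (simp add: strongly_connected_def card_gt_0_iff)

lemma ix_less: "u \<in> verts G \<Longrightarrow> ix u < N"
  using bij_betw_apply[OF bij] by auto

lemma ix_inj: "u \<in> verts G \<Longrightarrow> v \<in> verts G \<Longrightarrow> ix u = ix v \<longleftrightarrow> u = v"
  using bij by (auto simp: bij_betw_def inj_on_eq_iff)

lemma ix_surj: "i < N \<Longrightarrow> \<exists>u\<in>verts G. i = ix u"
  using bij by (auto simp: bij_betw_def)

lemma idist_ix: "u \<in> verts G \<Longrightarrow> v \<in> verts G \<Longrightarrow> idist (ix u) (ix v) = ddist G u v"
  using bij by (simp add: idist_def bij_betw_def)

lemma sum_ix: "(\<Sum>i<N. f i) = (\<Sum>u\<in>verts G. f (ix u))"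
  by (rule sum.reindex_bij_betw[OF bij, symmetric])

lemma adjacency_entry:
  assumes "u \<in> verts G" "v \<in> verts G"
  shows "M $$ (ix u, ix v) = (if u \<rightarrow> v then 1 else 0)"
proof -
  have "(\<exists>u' v'. u' \<rightarrow> v' \<and> ix u' = ix u \<and> ix v' = ix v) \<longleftrightarrow> u \<rightarrow> v"
  proof
    assume "\<exists>u' v'. u' \<rightarrow> v' \<and> ix u' = ix u \<and> ix v' = ix v"
    then obtain u' v' where *: "u' \<rightarrow> v'" "ix u' = ix u" "ix v' = ix v" by blast
    then show "u \<rightarrow> v"
      using ix_inj[OF adj_in_verts(1)[OF *(1)] assms(1)] ix_inj[OF adj_in_verts(2)[OF *(1)] assms(2)]
      by simp
  qed blast
  then show ?thesis using ix_less assms by (simp add: adjacency_mat_def)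
qed

abbreviation walks :: "nat \<Rightarrow> 'a \<Rightarrow> 'a \<Rightarrow> 'b list set" where
  "walks k u v \<equiv> {p. awalk u p v \<and> length p = k}"

lemma finite_walks: "finite (walks k u v)"
  by (rule finite_subset[OF _ finite_lists_length_eq[OF finite_arcs, of k]]) (auto simp: awalk_def)

text \<open>Without multiple arcs, the arcs leaving \<open>u\<close> correspond to its
  out-neighbours.\<close>

lemma sum_out_arcs:
  fixes f :: "'a \<Rightarrow> real"
  shows "(\<Sum>e | e \<in> arcs G \<and> tail G e = u. f (head G e)) = (\<Sum>w | w \<in> verts G \<and> u \<rightarrow> w. f w)"
proof (rule sum.reindex_bij_betw)
  show "bij_betw (head G) {e. e \<in> arcs G \<and> tail G e = u} {w. w \<in> verts G \<and> u \<rightarrow> w}"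
  proof (rule bij_betw_imageI)
    show "inj_on (head G) {e. e \<in> arcs G \<and> tail G e = u}"
      by (rule inj_onI) (auto intro: no_multi_arcs simp: arc_to_ends_def)
    show "head G ` {e. e \<in> arcs G \<and> tail G e = u} = {w. w \<in> verts G \<and> u \<rightarrow> w}"
      by (auto simp: arcs_ends_def arc_to_ends_def image_iff)
  qed
qed

text \<open>A walk of length \<open>Suc k\<close> is split at its first arc, matching
  \<open>M * M ^\<^sub>m k\<close>.\<close>

lemma pow_entry:
  assumes "u \<in> verts G" "v \<in> verts G"
  shows "(M ^\<^sub>m k) $$ (ix u, ix v) = real (card (walks k u v))"
  using assms
proof (induction k arbitrary: u)
  case 0
  have "walks 0 u v = (if u = v then {[]} else {})" using 0 by (auto simp: awalk_Nil_iff)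
  then show ?case using 0 M_carrier by (simp add: ix_less ix_inj)
next
  case (Suc k)
  let ?E = "{e. e \<in> arcs G \<and> tail G e = u}"
  have "walks (Suc k) u v = (\<lambda>(e, p). e # p) ` (SIGMA e:?E. walks k (head G e) v)"
    by (auto simp: length_Suc_conv awalk_Cons_iff image_iff)
  then have "card (walks (Suc k) u v) = card (SIGMA e:?E. walks k (head G e) v)"
    by (simp add: card_image inj_on_def)
  also have "\<dots> = (\<Sum>e\<in>?E. card (walks k (head G e) v))"
    by (rule card_SigmaI) (auto simp: finite_walks)
  finally have "real (card (walks (Suc k) u v)) = (\<Sum>e\<in>?E. real (card (walks k (head G e) v)))"
    by simp
  also have "\<dots> = (\<Sum>w | w \<in> verts G \<and> u \<rightarrow> w. real (card (walks k w v)))"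
    by (rule sum_out_arcs)
  also have "\<dots> = (\<Sum>w\<in>verts G. if u \<rightarrow> w then real (card (walks k w v)) else 0)"
    by (rule sum.inter_filter) simp
  also have "\<dots> = (\<Sum>w\<in>verts G. M $$ (ix u, ix w) * (M ^\<^sub>m k) $$ (ix w, ix v))"
    using Suc by (intro sum.cong) (auto simp: adjacency_entry)
  also have "\<dots> = (\<Sum>l<N. M $$ (ix u, l) * (M ^\<^sub>m k) $$ (l, ix v))"
    by (rule sum_ix[symmetric])
  also have "\<dots> = (M * M ^\<^sub>m k) $$ (ix u, ix v)"
    by (rule index_mult_sum[symmetric]) (use M_carrier Suc.prems ix_less in auto)
  finally show ?case by (simp only: pow_mat_Suc_left[OF M_carrier])
qed

section \<open>Directed distance and shortest walks\<close>

lemma ddist_walk: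
  assumes "u \<in> verts G" "v \<in> verts G" shows "\<exists>p. awalk u p v \<and> length p = ddist G u v"
proof -
  have "u \<rightarrow>\<^sup>* v" using strong assms by (simp add: strongly_connected_def)
  then obtain p where "awalk u p v" unfolding reachable_awalk by blast
  then have "\<exists>k p. awalk u p v \<and> length p = k" by blast
  then show ?thesis unfolding ddist_def by (rule LeastI_ex)
qed

lemma ddist_le: "awalk u p v \<Longrightarrow> ddist G u v \<le> length p"
  unfolding ddist_def by (rule Least_le) blast

lemma ddist_0: "u \<in> verts G \<Longrightarrow> v \<in> verts G \<Longrightarrow> ddist G u v = 0 \<longleftrightarrow> u = v"
  using ddist_walk[of u v] ddist_le[of u "[]" v] by (auto simp: awalk_Nil_iff)

lemma ddist_triangle:
  assumes "u \<in> verts G" "v \<in> verts G" "w \<in> verts G"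
  shows "ddist G u w \<le> ddist G u v + ddist G v w"
proof -
  obtain p where p: "awalk u p v" "length p = ddist G u v" using ddist_walk[OF assms(1,2)] by blast
  obtain q where q: "awalk v q w" "length q = ddist G v w" using ddist_walk[OF assms(2,3)] by blast
  show ?thesis using ddist_le[OF awalk_appendI[OF p(1) q(1)]] p(2) q(2) by simp
qed

lemma ddist_1:
  assumes "u \<in> verts G" "v \<in> verts G" shows "ddist G u v = 1 \<longleftrightarrow> u \<rightarrow> v"
proof
  assume "ddist G u v = 1"
  then obtain p where "awalk u p v" "length p = 1" using ddist_walk[OF assms] by auto
  then obtain e where "e \<in> arcs G" "tail G e = u" "head G e = v"
    by (auto simp: length_Suc_conv awalk_Cons_iff awalk_Nil_iff)
  then show "u \<rightarrow> v" by (auto simp: arcs_ends_def arc_to_ends_def)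
next
  assume "u \<rightarrow> v"
  then obtain e where e: "e \<in> arcs G" "tail G e = u" "head G e = v"
    by (auto simp: arcs_ends_def arc_to_ends_def)
  then have "ddist G u v \<le> 1" using ddist_le[OF arc_implies_awalk[OF e(1)]] by simp
  moreover have "ddist G u v \<noteq> 0" using ddist_0[OF assms] no_loops[OF e(1)] e by auto
  ultimately show "ddist G u v = 1" by simp
qed

text \<open>At a repeated vertex a nonempty closed subwalk could be cut out, giving a shorter
  walk.\<close>

lemma shortest_walk_apath:
  assumes "awalk u p v" "length p = ddist G u v" shows "apath u p v"
proof -
  have "distinct (awalk_verts u p)"
  proof (rule ccontr)
    assume nd: "\<not> distinct (awalk_verts u p)"
    obtain q r s where p: "p = q @ r @ s" and ex: "\<exists>w. awalk u q w \<and> awalk w r w \<and> awalk w s v"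
      and r: "closed_w r"
      by (rule awalk_cyc_decompE'[OF assms(1) nd])
    from ex obtain w where w: "awalk u q w" "awalk w s v" by blast
    have "ddist G u v \<le> length q + length s" using ddist_le[OF awalk_appendI[OF w]] by simp
    moreover have "0 < length r" using r unfolding closed_w_def by blast
    moreover have "length p = length q + length r + length s" using p by simp
    ultimately show False using assms(2) by linarith
  qed
  then show ?thesis using assms(1) by (simp add: apath_def)
qed

lemma num_paths_eq:
  assumes "u \<in> verts G" "v \<in> verts G"
  shows "real (num_paths G (ddist G u v) u v) = (M ^\<^sub>m ddist G u v) $$ (ix u, ix v)"
proof -
  have "{p. apath u p v \<and> length p = ddist G u v} = walks (ddist G u v) u v"
    using shortest_walk_apath by (auto simp: apath_def)
  then show ?thesis by (simp add: num_paths_def pow_entry[OF assms])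
qed

section \<open>Transfer of the excess and of distance-regularity to matrices\<close>

lemma dist_mat_idist:
  assumes "card (spectrum (complex_mat M)) = d + 1"
  shows "dist_mat N M d idist"
proof
  show "M \<in> carrier_mat N N" by (rule M_carrier)
  show "0 < N" by (rule N_pos)
  show "card (spectrum (complex_mat M)) = d + 1" by (rule assms)
next
  fix i j assume "i < N" "j < N"
  then obtain u v where uv: "u \<in> verts G" "v \<in> verts G" and ij: "i = ix u" "j = ix v"
    using ix_surj[of i] ix_surj[of j] by blast
  show "M $$ (i, j) = (if idist i j = 1 then 1 else 0)"
    unfolding ij idist_ix[OF uv] ddist_1[OF uv] by (rule adjacency_entry[OF uv])
  show "idist i j = 0 \<longleftrightarrow> i = j"
    unfolding ij idist_ix[OF uv] ddist_0[OF uv] ix_inj[OF uv] ..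
  show "(M ^\<^sub>m k) $$ (i, j) = 0" if "k < idist i j" for k
  proof -
    have "length p \<noteq> k" if "awalk u p v" for p
      using ddist_le[OF that] \<open>k < idist i j\<close> by (simp add: ij idist_ix[OF uv])
    then have none: "walks k u v = {}" by blast
    show ?thesis unfolding ij pow_entry[OF uv] none by simp
  qed
  have "walks (ddist G u v) u v \<noteq> {}" using ddist_walk[OF uv] by blast
  then show "0 < (M ^\<^sub>m idist i j) $$ (i, j)"
    unfolding ij idist_ix[OF uv] pow_entry[OF uv] using finite_walks by (simp add: card_gt_0_iff)
next
  fix i j k assume "i < N" "j < N" "k < N"
  then obtain u v w where "u \<in> verts G" "v \<in> verts G" "w \<in> verts G" "i = ix u" "j = ix v" "k = ix w"
    using ix_surj[of i] ix_surj[of j] ix_surj[of k] by blast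
  then show "idist i k \<le> idist i j + idist j k" by (simp add: idist_ix ddist_triangle)
qed

lemma sum_sphere:
  fixes f :: "'a \<Rightarrow> real"
  shows "(\<Sum>u\<in>sphere_out G k v. f u) = (\<Sum>u\<in>verts G. if ddist G v u = k then f u else 0)"
  unfolding sphere_out_def by (rule sum.inter_filter) simp

lemma ddist_le_diam:
  assumes "u \<in> verts G" "v \<in> verts G" shows "ddist G u v \<le> diam G"
proof -
  have "{ddist G u v | u v. u \<in> verts G \<and> v \<in> verts G} = (\<lambda>(u, v). ddist G u v) ` (verts G \<times> verts G)"
    by auto
  then have "finite {ddist G u v | u v. u \<in> verts G \<and> v \<in> verts G}" by simp
  then show ?thesis unfolding diam_def using assms by (intro Max_ge) auto
qed

lemma card_spheres:
  assumes uv: "u \<in> verts G" "v \<in> verts G"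
  shows "card (sphere_out G i u \<inter> sphere_out G k v)
    = card {w. w < N \<and> idist (ix u) w = i \<and> idist (ix v) w = k}"
proof -
  have "{w. w < N \<and> idist (ix u) w = i \<and> idist (ix v) w = k} = ix ` (sphere_out G i u \<inter> sphere_out G k v)"
    (is "?L = ?R")
  proof
    show "?L \<subseteq> ?R"
    proof
      fix w assume w: "w \<in> ?L"
      then obtain x where "x \<in> verts G" "w = ix x" using ix_surj by blast
      then show "w \<in> ?R" using w uv by (auto simp: sphere_out_def idist_ix)
    qed
    show "?R \<subseteq> ?L" using uv ix_less by (auto simp: sphere_out_def idist_ix)
  qed
  moreover have "inj_on ix (sphere_out G i u \<inter> sphere_out G k v)"
    using ix_inj by (auto simp: inj_on_def sphere_out_def)
  ultimately show ?thesis by (simp add: card_image)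
qed

context
  fixes d assumes spectrum_M: "card (spectrum (complex_mat M)) = d + 1"
begin

interpretation D: dist_mat N M d idist by (rule dist_mat_idist[OF spectrum_M])

lemma delta_eq: "delta G ix d = D.wdelta"
  unfolding delta_def D.wdelta_def sum_ix sum_sphere
  by (intro arg_cong[of _ _ "\<lambda>x. x / real N"] sum.cong refl) (auto simp: idist_ix hoffman_entry_def)

lemma delta'_eq: "delta' G ix d = D.wdelta'"
  unfolding delta'_def D.wdelta'_def sum_ix sum_sphere
  by (intro arg_cong[of _ _ "\<lambda>x. x / real N"] sum.cong refl)
    (auto simp: idist_ix hoffman_entry_def num_paths_eq)

text \<open>Beyond the diameter the spheres are empty and the quotient is \<open>0 / 0 = 0\<close>.\<close>

lemma weighted_excess_eq: "weighted_excess G ix d = D.wdelta'\<^sup>2 / D.wdelta"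
proof (cases "d \<le> diam G")
  case True
  then show ?thesis by (simp add: weighted_excess_def delta_eq delta'_eq)
next
  case False
  have "sphere_out G d v = {}" if "v \<in> verts G" for v
    using ddist_le_diam[OF that] False by (auto simp: sphere_out_def)
  then have "delta G ix d = 0" by (simp add: delta_def)
  then show ?thesis using False by (simp add: weighted_excess_def delta_eq)
qed

text \<open>No distance exceeds \<open>diam G\<close>, so both sides range over the same pairs,
  renamed by \<open>ix\<close>.\<close>

lemma distance_regular_iff: "distance_regular G \<longleftrightarrow> D.dreg"
proof
  assume "distance_regular G"
  then obtain s where s: "\<forall>k\<in>{1..diam G}. \<forall>i\<le>k + 1. \<forall>u\<in>verts G. \<forall>v\<in>verts G.
      ddist G u v = k \<longrightarrow> card (sphere_out G i u \<inter> sphere_out G 1 v) = s i k"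
    unfolding distance_regular_def by (elim exE)
  have "card {w. w < N \<and> idist a w = i \<and> idist b w = 1} = s i (idist a b)"
    if ab: "a < N" "b < N" and i: "i \<le> idist a b + 1" and pos: "1 \<le> idist a b" for a b i
  proof -
    obtain u v where uv: "u \<in> verts G" "v \<in> verts G" and e: "a = ix u" "b = ix v"
      using ix_surj ab by blast
    have "card (sphere_out G i u \<inter> sphere_out G 1 v) = s i (ddist G u v)"
      using s ddist_le_diam[OF uv] uv i pos by (simp add: e idist_ix[OF uv])
    then show ?thesis by (simp add: e idist_ix[OF uv] card_spheres[OF uv])
  qed
  then show D.dreg unfolding D.dreg_def by (intro exI[of _ s]) blast
next
  assume D.dreg
  then obtain s where s: "\<forall>a<N. \<forall>b<N. \<forall>i\<le>idist a b + 1. 1 \<le> idist a b \<longrightarrow>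
      card {w. w < N \<and> idist a w = i \<and> idist b w = 1} = s i (idist a b)"
    unfolding D.dreg_def by (elim exE)
  have "card (sphere_out G i u \<inter> sphere_out G 1 v) = s i (ddist G u v)"
    if uv: "u \<in> verts G" "v \<in> verts G" and i: "i \<le> ddist G u v + 1" and pos: "1 \<le> ddist G u v" for u v i
    using s ix_less[OF uv(1)] ix_less[OF uv(2)] i pos
    by (simp add: card_spheres[OF uv] idist_ix[OF uv])
  then show "distance_regular G" unfolding distance_regular_def by (intro exI[of _ s]) auto
qed

lemma weighted_excess_le: "weighted_excess G ix d \<le> spectral_excess M d"
  unfolding weighted_excess_eq by (rule D.excess_le)

lemma weighted_excess_eq_iff:
  assumes "normal_mat M"
  shows "weighted_excess G ix d = spectral_excess M d \<longleftrightarrow> distance_regular G"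
proof -
  interpret normal_dist_mat N M d idist by unfold_locales (rule assms)
  show ?thesis unfolding weighted_excess_eq distance_regular_iff by (rule excess_eq_iff_dreg)
qed

end

end

theorem mainTheorem11:
  fixes G :: "('a, 'b) pre_digraph" and ix :: "'a \<Rightarrow> nat" and d :: nat
  assumes "digraph G"
    and "strongly_connected G"
    and "bij_betw ix (verts G) {..<card (verts G)}"
    and "card (spectrum (complex_mat (adjacency_mat G ix))) = d + 1"
  shows "weighted_excess G ix d \<le> spectral_excess (adjacency_mat G ix) d \<and>
    (normal_mat (adjacency_mat G ix) \<longrightarrow>
      (weighted_excess G ix d = spectral_excess (adjacency_mat G ix) d \<longleftrightarrow> distance_regular G))"
proof -
  interpret indexed_digraph G ix
    using assms(1-3) by (simp add: indexed_digraph_def indexed_digraph_axioms_def)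
  show ?thesis
    using weighted_excess_le[OF assms(4)] weighted_excess_eq_iff[OF assms(4)] by blast
qed

end
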